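(* Let $k$ be an algebraically closed field of characteristic $p\ge 0$. Let $V\subseteq\mathbb{P}^n_k$ be the hypersurface cut out by a homogeneous polynomial $F\in k[t_0,\dots,t_n]$ of degree $d$. If $V$ is smooth and $p\nmid d$, then each vector field on $\mathbb{P}^n_k$ leaving $V$ invariant is induced by $$\sum_{i<j}P_{i,j}\,(\partial_jF\,\partial_i-\partial_iF\,\partial_j)$$ for certain homogeneous $P_{i,j}\in k[t_0,\dots,t_n]$ of equal degrees.
   Context: Vector fields: for an integer $m\ge 0$, a vector field of degree $m$ on $\mathbb{P}^n_k$ is a map of sheaves $X:\Omega^1_{\mathbb{P}^n_k}\to\mathcal{O}_{\mathbb{P}^n_k}(m-1)$. By the Euler sequence, it is induced by a homogeneous vector field $\sum_{i=0}^n G_i\partial_i$ on $\mathbb{A}^{n+1}_k$, with $G_i\in k[t_0,\dots,t_n]$ homogeneous of degree $m$ and $\partial_i=\partial/\partial t_i$; two such homogeneous fields induce the same $X$ if and only if they differ by a multiple $H\sum t_i\partial_i$ of the radial field. Invariance: a closed subscheme $V\subseteq\mathbb{P}^n_k$ is left invariant by $X$ if $X|_V$ factors through the natural surjection $\Omega^1_{\mathbb{P}^n_k}|_V\to\Omega^1_V$. For the hypersurface cut out by $F$ this means $\sum G_i\partial_iF=PF$ for some $P\in k[t_0,\dots,t_n]$. The zero polynomial is regarded as homogeneous of every degree. If $p=0$, the condition $p\nmid d$ always holds. *)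

theory Defs
  imports
    "HOL-Library.Poly_Mapping"
    "HOL-Computational_Algebra.Polynomial"
    "HOL-Computational_Algebra.Fraction_Field"
begin

text \<open>
  Polynomials have variables \<open>t\<^sub>0, t\<^sub>1, \<dots>\<close>; a monomial is its finitely supported exponent
  function. The ring \<open>k[t\<^sub>0, \<dots>, t\<^sub>n]\<close> is cut out by the condition on the variables in
  \<open>homogeneous n\<close> below.
\<close>

type_synonym 'k mpol = "(nat \<Rightarrow>\<^sub>0 nat) \<Rightarrow>\<^sub>0 'k"

definition const_pol :: "'k::zero \<Rightarrow> 'k mpol" where
  "const_pol c = Poly_Mapping.single 0 c"

definition eval_pol :: "(nat \<Rightarrow> 'k) \<Rightarrow> 'k::comm_semiring_1 mpol \<Rightarrow> 'k" where
  "eval_pol a f =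
     (\<Sum>\<mu>\<in>Poly_Mapping.keys f. Poly_Mapping.lookup f \<mu> *
        (\<Prod>i\<in>Poly_Mapping.keys \<mu>. a i ^ Poly_Mapping.lookup \<mu> i))"

text \<open>If \<open>t\<^sub>i\<close> does not occur in \<open>\<mu>\<close>, the truncated exponent is harmless: the coefficient is 0.\<close>

definition pdiff :: "nat \<Rightarrow> 'k::comm_semiring_1 mpol \<Rightarrow> 'k mpol" where
  "pdiff i f =
     (\<Sum>\<mu>\<in>Poly_Mapping.keys f.
        Poly_Mapping.single (\<mu> - Poly_Mapping.single i 1)
          (of_nat (Poly_Mapping.lookup \<mu> i) * Poly_Mapping.lookup f \<mu>))"

text \<open>Homogeneous elements of \<open>k[t\<^sub>0, \<dots>, t\<^sub>n]\<close> of degree \<open>q\<close>, including 0 for every \<open>q\<close>.\<close>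

definition homogeneous :: "nat \<Rightarrow> nat \<Rightarrow> 'k::zero mpol \<Rightarrow> bool" where
  "homogeneous n q f \<longleftrightarrow>
     (\<forall>\<mu>\<in>Poly_Mapping.keys f.
        Poly_Mapping.keys \<mu> \<subseteq> {..n} \<and> (\<Sum>i\<le>n. Poly_Mapping.lookup \<mu> i) = q)"

text \<open>
  Sheaves on \<open>\<bbbP>\<^sup>n\<close> are described on the basis of open sets \<open>D\<^sub>+(g)\<close>, \<open>g \<noteq> 0\<close> homogeneous of
  degree \<open>s > 0\<close>. With \<open>S = k[t\<^sub>0, \<dots>, t\<^sub>n]\<close>, the sections of \<open>\<O>(e)\<close> over \<open>D\<^sub>+(g)\<close> are the degree
  \<open>e\<close> part of \<open>S\<^sub>g\<close>; all of these lie in the fraction field, and restriction maps are inclusions.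
\<close>

definition twist_sections ::
    "nat \<Rightarrow> int \<Rightarrow> nat \<Rightarrow> 'k::idom mpol \<Rightarrow> 'k mpol fract set" where
  "twist_sections n e s g =
     {Fraction_Field.Fract a (g ^ r) | a q r.
        homogeneous n q a \<and> int q = e + int (r * s)}"

text \<open>
  With \<open>\<I>\<close> the ideal sheaf of the hypersurface cut out by \<open>F\<close> of degree \<open>d\<close>: the sections of
  \<open>\<I> \<cdot> \<O>(e)\<close> over \<open>D\<^sub>+(g)\<close> are the degree \<open>e\<close> part of \<open>F S\<^sub>g\<close>.
\<close>

definition ideal_sections ::
    "nat \<Rightarrow> nat \<Rightarrow> 'k::idom mpol \<Rightarrow> int \<Rightarrow> nat \<Rightarrow> 'k mpol \<Rightarrow> 'k mpol fract set" where
  "ideal_sections n d F e s g =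
     {Fraction_Field.Fract (a * F) (g ^ r) | a q r.
        homogeneous n q a \<and> int (q + d) = e + int (r * s)}"

text \<open>
  A map of sheaves \<open>\<Omega>\<^sup>1 \<rightarrow> \<O>(m - 1)\<close> is, by the universal property of \<open>\<Omega>\<^sup>1\<close>, a \<open>k\<close>-linear derivation
  \<open>\<O> \<rightarrow> \<O>(m - 1)\<close>, that is, a family of derivations over the \<open>D\<^sub>+(g)\<close> compatible with restriction.
  As restriction maps are inclusions, such a family is a single function on the union of the
  \<open>\<O>(D\<^sub>+(g))\<close>. Values of \<open>X\<close> at other elements of the fraction field are irrelevant.
\<close>

definition vector_field ::
    "nat \<Rightarrow> nat \<Rightarrow> ('k::idom mpol fract \<Rightarrow> 'k mpol fract) \<Rightarrow> bool" where
  "vector_field n m X \<longleftrightarrow>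
     (\<forall>s g. 0 < s \<and> homogeneous n s g \<and> g \<noteq> 0 \<longrightarrow>
        (\<forall>u\<in>twist_sections n 0 s g. X u \<in> twist_sections n (int m - 1) s g) \<and>
        (\<forall>u\<in>twist_sections n 0 s g. \<forall>v\<in>twist_sections n 0 s g.
           X (u + v) = X u + X v \<and> X (u * v) = u * X v + v * X u)) \<and>
     (\<forall>c. X (Fraction_Field.Fract (const_pol c) 1) = 0)"

text \<open>
  The kernel of \<open>\<Omega>\<^sup>1|\<^sub>V \<rightarrow> \<Omega>\<^sup>1\<^sub>V\<close> is generated by the classes of \<open>df\<close> for local sections \<open>f\<close> of
  \<open>\<I>\<close>, so \<open>X|\<^sub>V\<close> factors through \<open>\<Omega>\<^sup>1\<^sub>V\<close> iff the derivation maps \<open>\<I>\<close> to \<open>\<I> \<cdot> \<O>(m - 1)\<close>, that is,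
  descends to a derivation from \<open>\<O>\<^sub>V\<close> to \<open>\<O>\<^sub>V(m - 1)\<close>.
\<close>

definition leaves_invariant ::
    "nat \<Rightarrow> nat \<Rightarrow> nat \<Rightarrow> 'k::idom mpol \<Rightarrow> ('k mpol fract \<Rightarrow> 'k mpol fract) \<Rightarrow> bool" where
  "leaves_invariant n m d F X \<longleftrightarrow>
     (\<forall>s g. 0 < s \<and> homogeneous n s g \<and> g \<noteq> 0 \<longrightarrow>
        (\<forall>u\<in>ideal_sections n d F 0 s g. X u \<in> ideal_sections n d F (int m - 1) s g))"

text \<open>
  A vector field \<open>\<Sum>\<^sub>i G\<^sub>i \<partial>\<^sub>i\<close> on affine \<open>(n+1)\<close>-space is given by its coefficients
  \<open>G\<^sub>0, \<dots>, G\<^sub>n\<close>. Homogeneous of degree \<open>m\<close>, it induces the vector field on \<open>\<bbbP>\<^sup>n\<close> that is its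
  action on degree 0 fractions by the quotient rule.
\<close>

definition apply_field :: "nat \<Rightarrow> (nat \<Rightarrow> 'k mpol) \<Rightarrow> 'k::comm_semiring_1 mpol \<Rightarrow> 'k mpol" where
  "apply_field n G f = (\<Sum>i\<le>n. G i * pdiff i f)"

definition coord_field :: "nat \<Rightarrow> nat \<Rightarrow> 'k::comm_semiring_1 mpol" where
  "coord_field i = (\<lambda>l. if l = i then 1 else 0)"

definition induces ::
    "nat \<Rightarrow> nat \<Rightarrow> (nat \<Rightarrow> 'k::idom mpol) \<Rightarrow> ('k mpol fract \<Rightarrow> 'k mpol fract) \<Rightarrow> bool" where
  "induces n m G X \<longleftrightarrow>
     (\<forall>i\<le>n. homogeneous n m (G i)) \<and>
     (\<forall>q a b. homogeneous n q a \<and> homogeneous n q b \<and> b \<noteq> 0 \<longrightarrow>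
        X (Fraction_Field.Fract a b) =
          Fraction_Field.Fract (b * apply_field n G a - a * apply_field n G b) (b ^ 2))"

text \<open>
  Smoothness over an algebraically closed field, by the Jacobian condition on the chart \<open>t\<^sub>i = 1\<close>:
  at the points of the hypersurface with \<open>a\<^sub>i = 1\<close>, the partial derivatives with respect to the
  affine coordinates \<open>t\<^sub>j\<close>, \<open>j \<noteq> i\<close>, are not all 0.
\<close>

definition smooth_hypersurface :: "nat \<Rightarrow> 'k::comm_semiring_1 mpol \<Rightarrow> bool" where
  "smooth_hypersurface n F \<longleftrightarrow>
     (\<forall>i\<le>n. \<forall>a. a i = 1 \<and> eval_pol a F = 0 \<longrightarrow>
        (\<exists>j\<le>n. j \<noteq> i \<and> eval_pol a (pdiff j F) \<noteq> 0))"

end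

theory Submission
  imports Defs "HOL-Computational_Algebra.Polynomial_Factorial"
begin

text \<open>
  A vector field \<open>X\<close> is lifted to \<open>\<Sum> G\<^sub>i \<partial>\<^sub>i\<close> by hand: \<open>W\<^sub>i\<^sub>j = t\<^sub>i\<^sup>2 X (t\<^sub>j / t\<^sub>i)\<close> is regular on
  \<open>D\<^sub>+(t\<^sub>i)\<close> and, up to sign, on \<open>D\<^sub>+(t\<^sub>j)\<close>, hence a polynomial, and the cocycle relation
  \<open>t\<^sub>j W\<^sub>i\<^sub>l = t\<^sub>l W\<^sub>i\<^sub>j + t\<^sub>i W\<^sub>j\<^sub>l\<close> allows one to solve \<open>W\<^sub>0\<^sub>j = t\<^sub>0 G\<^sub>j - t\<^sub>j G\<^sub>0\<close>. Invariance gives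
  \<open>\<Sum> G\<^sub>i \<partial>\<^sub>i F = P F\<close>; as \<open>p\<close> does not divide \<open>d\<close>, subtracting \<open>P/d\<close> times the radial field makes the
  right-hand side 0. By smoothness and the Euler identity the partial derivatives of \<open>F\<close> have no
  common zero besides the origin, so by the Nullstellensatz the ideal they generate contains powers
  of all \<open>t\<^sub>i\<close>. These form a regular sequence of the same length as the sequence of the partial
  derivatives, which therefore has a vanishing first Koszul homology: the syzygy \<open>G\<close> is a Koszul
  syzygy.
\<close>

section \<open>Exactness of the Koszul complex\<close>

text \<open>Regularity, cancellation and gluing between charts are only ever needed for powers of
  variables, where they can be read off exponents. This is why the partial derivatives, whose
  regularity is not visible, are compared with such powers. The polynomial type has infinitely many
  variables, and neither the Koszul argument nor the solution of the cocycle relation respects the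
  grading. Both are carried out in the whole ring with unrestricted coefficients. Since the given
  data are homogeneous, \<open>hcomp (Suc n)\<close> afterwards removes foreign variables and wrong
  degrees at once. The condition on the characteristic acts twice: besides the radial correction,
  smoothness says nothing at points off V, and it is the Euler identity with d invertible that
  forces a common zero of the partial derivatives onto V.\<close>

definition koszul_sign :: "nat \<Rightarrow> nat set \<Rightarrow> 'r::comm_ring_1" where
  "koszul_sign j A = (-1) ^ card {i\<in>A. i < j}"

text \<open>Contraction with \<open>f\<close> on the exterior algebra, \<open>z A\<close> being the
  coefficient of the basis element e_A. The sign \<open>koszul_sign j A\<close> is the one in e_j
  wedge e_A = +-e_(insert j A); as \<open>j\<close> itself is not counted, it is the same for
  \<open>A\<close>, \<open>insert j A\<close> and \<open>A - {j}\<close>.\<close>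

definition koszul_boundary ::
    "nat \<Rightarrow> (nat \<Rightarrow> 'r::comm_ring_1) \<Rightarrow> (nat set \<Rightarrow> 'r) \<Rightarrow> nat set \<Rightarrow> 'r" where
  "koszul_boundary n f z A = (\<Sum>j\<in>{..n} - A. koszul_sign j A * f j * z (insert j A))"

text \<open>Exterior multiplication from the left by the vector with coordinates
  \<open>c j\<close>.\<close>

definition koszul_wedge ::
    "(nat \<Rightarrow> 'r::comm_ring_1) \<Rightarrow> (nat set \<Rightarrow> 'r) \<Rightarrow> nat set \<Rightarrow> 'r" where
  "koszul_wedge c z A = (\<Sum>j\<in>A. koszul_sign j A * c j * z (A - {j}))"

lemma koszul_sign_square [simp]: "koszul_sign j A * koszul_sign j A = (1::'r::comm_ring_1)"
  by (simp add: koszul_sign_def flip: power_mult_distrib)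

lemma koszul_sign_insert:
  assumes "finite A" "j \<notin> A"
  shows "koszul_sign k (insert j A) = (if j < k then - koszul_sign k A else koszul_sign k A)"
proof -
  have "{i \<in> insert j A. i < k} = (if j < k then insert j {i\<in>A. i < k} else {i\<in>A. i < k})"
    by auto
  then show ?thesis using assms by (simp add: koszul_sign_def)
qed

text \<open>Inserting two indices in either order gives the same set, but only the larger index
  counts the smaller one, so exchanging them flips exactly one sign and the terms cancel in
  pairs.\<close>

lemma koszul_boundary_boundary:
  assumes "finite A"
  shows "koszul_boundary n f (koszul_boundary n f z) A = 0"
proof -
  define t where "t j k = koszul_sign j A * koszul_sign k (insert j A) * f j * f k
      * z (insert j (insert k A))" for j k
  define B where "B = {..n} - A"
  have anti: "t k j = - t j k" if "j \<in> B" "k \<in> B" "j < k" for j k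
    using that assms
    by (simp add: t_def B_def koszul_sign_insert insert_commute ac_simps)
  have fin: "finite B" by (simp add: B_def)
  have "koszul_boundary n f (koszul_boundary n f z) A = (\<Sum>j\<in>B. \<Sum>k\<in>B - {j}. t j k)"
    unfolding koszul_boundary_def t_def B_def sum_distrib_left
    by (intro sum.cong) (auto simp: algebra_simps insert_commute)
  also have "\<dots> = (\<Sum>(j,k)\<in>(SIGMA j:B. B - {j}). t j k)"
    using fin by (intro sum.Sigma) auto
  also have "(SIGMA j:B. B - {j}) = {(j,k). j \<in> B \<and> k \<in> B \<and> j < k} \<union> {(j,k). j \<in> B \<and> k \<in> B \<and> k < j}"
    by auto
  also have "(\<Sum>(j,k)\<in>\<dots>. t j k) =
      (\<Sum>(j,k)\<in>{(j,k). j \<in> B \<and> k \<in> B \<and> j < k}. t j k) +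
      (\<Sum>(j,k)\<in>{(j,k). j \<in> B \<and> k \<in> B \<and> k < j}. t j k)"
    using fin by (intro sum.union_disjoint) (auto intro: finite_subset[of _ "B \<times> B"])
  also have "(\<Sum>(j,k)\<in>{(j,k). j \<in> B \<and> k \<in> B \<and> k < j}. t j k) =
      (\<Sum>(j,k)\<in>{(j,k). j \<in> B \<and> k \<in> B \<and> j < k}. t k j)"
    by (rule sum.reindex_bij_witness[of _ prod.swap prod.swap]) auto
  also have "\<dots> = (\<Sum>(j,k)\<in>{(j,k). j \<in> B \<and> k \<in> B \<and> j < k}. - t j k)"
    by (intro sum.cong) (auto simp: anti)
  also have "\<dots> = - (\<Sum>(j,k)\<in>{(j,k). j \<in> B \<and> k \<in> B \<and> j < k}. t j k)"
    by (simp add: case_prod_unfold sum_negf)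
  finally show ?thesis by simp
qed

text \<open>Contraction is an antiderivation. Of the diagonal terms \<open>c j * f j * z A\<close>,
  those with \<open>j\<close> outside \<open>A\<close> come from the first summand and those with
  \<open>j\<close> in \<open>A\<close> from the second; the mixed terms \<open>t j k\<close> occur
  in both with opposite signs.\<close>

lemma koszul_homotopy:
  assumes A: "A \<subseteq> {..n}"
  shows "koszul_boundary n f (koszul_wedge c z) A + koszul_wedge c (koszul_boundary n f z) A
       = (\<Sum>j\<le>n. c j * f j) * z A"
proof -
  have fin: "finite A" using A finite_subset by blast
  define B where "B = {..n} - A"
  have finB: "finite B" and AB: "A \<inter> B = {}" and un: "{..n} = A \<union> B" using A by (auto simp: B_def)
  define t where "t j k = koszul_sign j A * koszul_sign k (insert j A) * f j * c k
      * z (insert j (A - {k}))" for j k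
  have 1: "koszul_boundary n f (koszul_wedge c z) A =
      (\<Sum>j\<in>B. c j * f j * z A) + (\<Sum>j\<in>B. \<Sum>k\<in>A. t j k)"
  proof -
    have "koszul_boundary n f (koszul_wedge c z) A =
        (\<Sum>j\<in>B. koszul_sign j A * f j * koszul_wedge c z (insert j A))"
      by (simp add: koszul_boundary_def B_def)
    also have "\<dots> = (\<Sum>j\<in>B. c j * f j * z A + (\<Sum>k\<in>A. t j k))"
    proof (intro sum.cong refl)
      fix j assume j: "j \<in> B"
      then have jA: "j \<notin> A" by (auto simp: B_def)
      have "koszul_wedge c z (insert j A) = koszul_sign j A * c j * z A +
         (\<Sum>k\<in>A. koszul_sign k (insert j A) * c k * z (insert j (A - {k})))"
        using jA fin unfolding koszul_wedge_def
        by (auto simp: koszul_sign_insert insert_Diff_if intro!: sum.cong)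
      then have "koszul_sign j A * f j * koszul_wedge c z (insert j A) =
         (koszul_sign j A * koszul_sign j A) * (c j * f j * z A) + (\<Sum>k\<in>A. t j k)"
        unfolding t_def by (simp add: algebra_simps sum_distrib_left)
      then show "koszul_sign j A * f j * koszul_wedge c z (insert j A) =
         c j * f j * z A + (\<Sum>k\<in>A. t j k)" by simp
    qed
    finally show ?thesis by (simp add: sum.distrib)
  qed
  have 2: "koszul_wedge c (koszul_boundary n f z) A =
      (\<Sum>k\<in>A. c k * f k * z A) - (\<Sum>k\<in>A. \<Sum>j\<in>B. t j k)"
  proof -
    have "koszul_wedge c (koszul_boundary n f z) A = (\<Sum>k\<in>A. c k * f k * z A - (\<Sum>j\<in>B. t j k))"
      unfolding koszul_wedge_def
    proof (intro sum.cong refl)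
      fix k assume k: "k \<in> A"
      define A' where "A' = A - {k}"
      have A': "A = insert k A'" "k \<notin> A'" "finite A'" using k fin by (auto simp: A'_def)
      have ks: "koszul_sign k A = (koszul_sign k A' :: 'a)" using A' by (simp add: koszul_sign_insert)
      have "{..n} - A' = insert k B" using A k by (auto simp: B_def A'_def)
      then have "koszul_boundary n f z A' = koszul_sign k A' * f k * z A +
         (\<Sum>j\<in>B. koszul_sign j A' * f j * z (insert j A'))"
        using finB k by (simp add: koszul_boundary_def B_def flip: A'(1))
      then have "koszul_sign k A * c k * koszul_boundary n f z A' =
         (koszul_sign k A' * koszul_sign k A') * (c k * f k * z A) +
         (\<Sum>j\<in>B. koszul_sign k A' * koszul_sign j A' * f j * c k * z (insert j A'))"
        by (simp add: ks algebra_simps sum_distrib_left)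
      also have "(\<Sum>j\<in>B. koszul_sign k A' * koszul_sign j A' * f j * c k * z (insert j A')) =
          (\<Sum>j\<in>B. - t j k)"
      proof (intro sum.cong refl)
        fix j assume "j \<in> B"
        then have j: "j \<noteq> k" "j \<notin> A'" using A' by (auto simp: B_def)
        have "koszul_sign k (insert j A) = (if j < k then - koszul_sign k A' else (koszul_sign k A' :: 'a))"
          using \<open>j \<in> B\<close> ks by (simp add: B_def koszul_sign_insert[OF fin])
        moreover have "koszul_sign j A = (if k < j then - koszul_sign j A' else (koszul_sign j A' :: 'a))"
          using koszul_sign_insert[OF A'(3,2), of j] A'(1) by simp
        ultimately show "koszul_sign k A' * koszul_sign j A' * f j * c k * z (insert j A') = - t j k"
          using j(1) unfolding t_def A'_def[symmetric] by (cases "j < k") (simp_all add: mult.commute)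
      qed
      finally show "koszul_sign k A * c k * koszul_boundary n f z (A - {k}) =
          c k * f k * z A - (\<Sum>j\<in>B. t j k)"
        by (simp add: A'_def sum_negf)
    qed
    then show ?thesis by (simp add: sum_subtractf)
  qed
  have 3: "(\<Sum>j\<in>B. \<Sum>k\<in>A. t j k) = (\<Sum>k\<in>A. \<Sum>j\<in>B. t j k)" by (rule sum.swap)
  show ?thesis unfolding 1 2 3 un using fin finB AB
    by (simp add: sum.union_disjoint distrib_right sum_distrib_right)
qed

lemma koszul_boundary_add:
  "koszul_boundary n f (\<lambda>A. y A + z A) A = koszul_boundary n f y A + koszul_boundary n f z A"
  by (simp add: koszul_boundary_def algebra_simps sum.distrib)

lemma koszul_boundary_mult:
  "koszul_boundary n f (\<lambda>A. x * z A) A = x * koszul_boundary n f z A"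
  by (simp add: koszul_boundary_def algebra_simps sum_distrib_left)

lemma koszul_boundary_cong:
  assumes "\<And>j. j \<in> {..n} - A \<Longrightarrow> y (insert j A) = z (insert j A)"
  shows "koszul_boundary n f y A = koszul_boundary n f z A"
  unfolding koszul_boundary_def using assms by (intro sum.cong) auto

definition is_ideal :: "'r::comm_ring_1 set \<Rightarrow> bool" where
  "is_ideal I \<longleftrightarrow> 0 \<in> I \<and> (\<forall>x\<in>I. \<forall>y\<in>I. x + y \<in> I) \<and> (\<forall>r. \<forall>x\<in>I. r * x \<in> I)"

lemma is_ideal_add: "is_ideal I \<Longrightarrow> x \<in> I \<Longrightarrow> y \<in> I \<Longrightarrow> x + y \<in> I"
  and is_ideal_mult: "is_ideal I \<Longrightarrow> x \<in> I \<Longrightarrow> r * x \<in> I"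
  and is_ideal_zero: "is_ideal I \<Longrightarrow> 0 \<in> I"
  by (auto simp: is_ideal_def)

lemma is_ideal_sum: "is_ideal I \<Longrightarrow> (\<And>a. a \<in> S \<Longrightarrow> g a \<in> I) \<Longrightarrow> sum g S \<in> I"
  by (induction S rule: infinite_finite_induct) (auto simp: is_ideal_zero is_ideal_add)

text \<open>
  Multiplication by an element of the ideal generated by \<open>f\<close> is null-homotopic on the Koszul
  complex, so dividing by one more element of a regular sequence in that ideal lowers the degree
  in which a cycle is known to be a boundary by one. There is nothing to prove in degree \<open>n + 2\<close>.
\<close>

lemma koszul_exact_mod:
  fixes f x :: "nat \<Rightarrow> 'r::comm_ring_1"
  assumes ideal: "\<And>j. is_ideal (J j)"
    and Suc: "\<And>j p. p \<in> J (Suc j) \<Longrightarrow> \<exists>u\<in>J j. \<exists>v. p = u + x j * v"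
    and Suc': "\<And>j u v. u \<in> J j \<Longrightarrow> u + x j * v \<in> J (Suc j)"
    and regular: "\<And>j v. x j * v \<in> J j \<Longrightarrow> v \<in> J j"
    and x: "\<And>j. j \<le> n \<Longrightarrow> x j = (\<Sum>l\<le>n. c j l * f l)"
    and "j \<le> Suc n"
    and "\<And>A. A \<subseteq> {..n} \<Longrightarrow> card A = j \<Longrightarrow> koszul_boundary n f z A \<in> J j"
  shows "\<exists>w. \<forall>A\<subseteq>{..n}. card A = Suc j \<longrightarrow> z A - koszul_boundary n f w A \<in> J j"
  using assms(6,7)
proof (induction j arbitrary: z rule: inc_induct)
  case base
  have "card A \<noteq> Suc (Suc n)" if "A \<subseteq> {..n}" for A
    using card_mono[OF _ that] by simp
  then show ?case by blast
next
  case (step j)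
  define c' where "c' = c j"
  have xj: "x j = (\<Sum>l\<le>n. c' l * f l)" using step x by (simp add: c'_def)
  \<comment> \<open>By the homotopy, the boundary of \<open>y\<close> is \<open>x j * z\<close> up
    to \<open>J j\<close>, so \<open>y\<close> is a cycle modulo \<open>J (Suc j)\<close> one degree
    higher. Once \<open>y\<close> is the boundary of \<open>w\<close> plus
    \<open>u + x j * v\<close>, its boundary is also \<open>x j\<close> times that of
    \<open>v\<close> up to \<open>J j\<close>, and regularity cancels \<open>x j\<close>.\<close>
  define y where "y = koszul_wedge c' z"
  have wedge: "koszul_wedge c' (koszul_boundary n f z) A \<in> J j" if "A \<subseteq> {..n}" "card A = Suc j" for A
    unfolding koszul_wedge_def
  proof (intro is_ideal_sum ideal is_ideal_mult step.prems)
    fix k assume "k \<in> A"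
    then show "A - {k} \<subseteq> {..n}" "card (A - {k}) = j" using that by auto
  qed
  have bd: "koszul_boundary n f y A = x j * z A - koszul_wedge c' (koszul_boundary n f z) A"
    if "A \<subseteq> {..n}" for A
    using koszul_homotopy[OF that, of f c' z] by (simp add: y_def xj algebra_simps)
  have "koszul_boundary n f y A \<in> J (Suc j)" if "A \<subseteq> {..n}" "card A = Suc j" for A
    using Suc'[OF is_ideal_mult[OF ideal wedge[OF that], of "-1"], of "z A"] that by (simp add: bd)
  from step.IH[OF this] obtain w where
    w: "\<And>A. A \<subseteq> {..n} \<Longrightarrow> card A = Suc (Suc j) \<Longrightarrow> y A - koszul_boundary n f w A \<in> J (Suc j)"
    by blast
  have "\<exists>u v. A \<subseteq> {..n} \<and> card A = Suc (Suc j) \<longrightarrow>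
     u \<in> J j \<and> y A = koszul_boundary n f w A + u + x j * v" for A
    using Suc[OF w[of A]] by (metis add.assoc add_diff_cancel_left' diff_add_cancel add.commute)
  then obtain u v where uv: "\<And>A. A \<subseteq> {..n} \<Longrightarrow> card A = Suc (Suc j) \<Longrightarrow> u A \<in> J j"
    "\<And>A. A \<subseteq> {..n} \<Longrightarrow> card A = Suc (Suc j) \<Longrightarrow> y A = koszul_boundary n f w A + u A + x j * v A"
    by metis
  have "z A - koszul_boundary n f v A \<in> J j" if A: "A \<subseteq> {..n}" "card A = Suc j" for A
  proof -
    have fin: "finite A" using A finite_subset by blast
    have ins: "insert k A \<subseteq> {..n}" "card (insert k A) = Suc (Suc j)" if "k \<in> {..n} - A" for k
      using that A fin by auto
    have "koszul_boundary n f y A =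
       koszul_boundary n f (\<lambda>A. koszul_boundary n f w A + u A + x j * v A) A"
      by (rule koszul_boundary_cong) (use uv ins in auto)
    also have "\<dots> = koszul_boundary n f u A + x j * koszul_boundary n f v A"
      by (simp add: koszul_boundary_add koszul_boundary_mult koszul_boundary_boundary fin)
    finally have "x j * (z A - koszul_boundary n f v A) =
        koszul_boundary n f u A + koszul_wedge c' (koszul_boundary n f z) A"
      using bd[OF A(1)] by (simp add: algebra_simps)
    also have "\<dots> \<in> J j"
      by (intro is_ideal_add ideal wedge A)
         (auto simp: koszul_boundary_def intro!: is_ideal_sum ideal is_ideal_mult uv ins)
    finally show ?thesis by (rule regular)
  qed
  then show ?case by blast
qed

text \<open>A syzygy is a cycle of degree 1, stored on singletons, and exactness modulo the zero
  ideal \<open>J 0\<close> makes it the boundary of a chain of degree 2. The two sums are that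
  boundary split at \<open>l\<close>.\<close>

lemma koszul_syzygy:
  fixes f G x :: "nat \<Rightarrow> 'r::comm_ring_1"
  assumes ideal: "\<And>j. is_ideal (J j)" and "J 0 = {0}"
    and "\<And>j p. p \<in> J (Suc j) \<Longrightarrow> \<exists>u\<in>J j. \<exists>v. p = u + x j * v"
    and "\<And>j u v. u \<in> J j \<Longrightarrow> u + x j * v \<in> J (Suc j)"
    and "\<And>j v. x j * v \<in> J j \<Longrightarrow> v \<in> J j"
    and "\<And>j. j \<le> n \<Longrightarrow> x j = (\<Sum>l\<le>n. c j l * f l)"
    and syz: "(\<Sum>j\<le>n. G j * f j) = 0"
  shows "\<exists>P. \<forall>l\<le>n. G l = (\<Sum>j\<in>{l<..n}. P l j * f j) - (\<Sum>j<l. P j l * f j)"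
proof -
  define z where "z A = G (the_elem A)" for A
  have "koszul_boundary n f z A \<in> J 0" if "A \<subseteq> {..n}" "card A = 0" for A
  proof -
    have "A = {}" using that finite_subset[OF that(1)] by simp
    then have "koszul_boundary n f z A = (\<Sum>j\<le>n. G j * f j)"
      by (simp add: koszul_boundary_def koszul_sign_def z_def mult.commute)
    then show ?thesis using syz assms(2) by simp
  qed
  from koszul_exact_mod[of J x n c f 0, OF assms(1,3-6) _ this]
  obtain w where "\<forall>A\<subseteq>{..n}. card A = Suc 0 \<longrightarrow> z A - koszul_boundary n f w A \<in> J 0"
    by blast
  then have w: "z A = koszul_boundary n f w A" if "A \<subseteq> {..n}" "card A = 1" for A
    using that unfolding \<open>J 0 = {0}\<close> by simp
  \<comment> \<open>The Koszul sign at \<open>{l}\<close> is -1 for \<open>j > l\<close> and 1 for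
    \<open>j < l\<close>, hence the negative of \<open>w\<close> as the witness.\<close>
  have "G l = (\<Sum>j\<in>{l<..n}. - w {l, j} * f j) - (\<Sum>j<l. - w {j, l} * f j)" if "l \<le> n" for l
  proof -
    have "G l = koszul_boundary n f w {l}" using w[of "{l}"] that by (simp add: z_def)
    also have "\<dots> = (\<Sum>j\<in>{..n} - {l}. koszul_sign j {l} * f j * w {j, l})"
      by (simp add: koszul_boundary_def)
    also have "{..n} - {l} = {l<..n} \<union> {..<l}" using that by auto
    also have "(\<Sum>j\<in>\<dots>. koszul_sign j {l} * f j * w {j, l}) =
        (\<Sum>j\<in>{l<..n}. koszul_sign j {l} * f j * w {j, l}) + (\<Sum>j<l. koszul_sign j {l} * f j * w {j, l})"
      by (intro sum.union_disjoint) auto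
    also have "(\<Sum>j\<in>{l<..n}. koszul_sign j {l} * f j * w {j, l}) = (\<Sum>j\<in>{l<..n}. - w {l, j} * f j)"
    proof (intro sum.cong refl)
      fix j assume "j \<in> {l<..n}"
      then have "koszul_sign j {l} = (-1 :: 'r)" by (simp add: koszul_sign_insert koszul_sign_def[of _ "{}"])
      then show "koszul_sign j {l} * f j * w {j, l} = - w {l, j} * f j"
        by (simp add: insert_commute[of j l] mult.commute)
    qed
    also have "(\<Sum>j<l. koszul_sign j {l} * f j * w {j, l}) = - (\<Sum>j<l. - w {j, l} * f j)"
      unfolding sum_negf[symmetric]
      by (intro sum.cong) (auto simp: koszul_sign_insert koszul_sign_def[of _ "{}"] mult.commute)
    finally show ?thesis by simp
  qed
  then show ?thesis
    by (intro exI[of _ "\<lambda>i j. - w {i, j}"] allI impI)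
qed

section \<open>Polynomials and homogeneous components\<close>

abbreviation lookup where "lookup \<equiv> Poly_Mapping.lookup"
abbreviation keys where "keys \<equiv> Poly_Mapping.keys"
abbreviation single where "single \<equiv> Poly_Mapping.single"

text \<open>Terms are split off a fixed \<open>p\<close>, so every monomial met on the way is one of
  \<open>p\<close>. Hypotheses on the monomials of \<open>p\<close>, such as their degree or their
  variables, stay available without being carried through the induction.\<close>

lemma poly_mapping_add_single_induct [case_names zero add]:
  fixes p :: "'a \<Rightarrow>\<^sub>0 'b::comm_monoid_add"
  assumes "P 0"
    and "\<And>\<mu> c q. c \<noteq> 0 \<Longrightarrow> \<mu> \<in> keys p \<Longrightarrow> keys q \<subseteq> keys p \<Longrightarrow> P q \<Longrightarrow> P (single \<mu> c + q)"
  shows "P p"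
proof -
  have "P (\<Sum>\<mu>\<in>S. single \<mu> (lookup p \<mu>)) \<and> keys (\<Sum>\<mu>\<in>S. single \<mu> (lookup p \<mu>)) \<subseteq> S"
    if "finite S" "S \<subseteq> keys p" for S
    using that
  proof (induction S)
    case (insert \<mu> S)
    define q where "q = (\<Sum>\<mu>\<in>S. single \<mu> (lookup p \<mu>))"
    have q: "P q" "keys q \<subseteq> S" using insert by (simp_all add: q_def)
    have "P (single \<mu> (lookup p \<mu>) + q)"
      using insert.prems q by (intro assms(2)) (auto simp: in_keys_iff)
    moreover have "keys (single \<mu> (lookup p \<mu>) + q) \<subseteq> insert \<mu> S"
      using keys_add[of "single \<mu> (lookup p \<mu>)" q] q(2) by (auto split: if_splits)
    ultimately show ?case using insert.hyps by (simp add: q_def)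
  qed (simp add: assms(1))
  from this[OF finite_keys subset_refl] have "P (\<Sum>\<mu>\<in>keys p. single \<mu> (lookup p \<mu>))" ..
  also have "(\<Sum>\<mu>\<in>keys p. single \<mu> (lookup p \<mu>)) = p"
    by (rule poly_mapping_eqI) (simp add: lookup_sum lookup_single when_def in_keys_iff)
  finally show ?thesis .
qed

lemma lookup_single_mult:
  fixes p :: "'k::comm_semiring_1 mpol"
  shows "lookup (single \<nu> c * p) (\<nu> + \<mu>) = c * lookup p \<mu>"
proof (induction p rule: poly_mapping_add_single_induct)
  case (add \<mu> c q)
  then show ?case by (simp add: distrib_left lookup_add mult_single lookup_single when_def)
qed simp

lemma keys_single_mult_subset:
  fixes p :: "'k::comm_semiring_1 mpol"
  shows "keys (single \<nu> c * p) \<subseteq> (\<lambda>\<mu>. \<nu> + \<mu>) ` keys p"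
proof
  fix \<mu> assume "\<mu> \<in> keys (single \<nu> c * p)"
  then obtain a b where "a \<in> keys (single \<nu> c)" "b \<in> keys p" "\<mu> = a + b"
    using keys_mult[of "single \<nu> c" p] by blast
  then show "\<mu> \<in> (\<lambda>\<mu>. \<nu> + \<mu>) ` keys p" by (auto split: if_splits)
qed

lemma keys_single_1_mult:
  fixes p :: "'k::comm_semiring_1 mpol"
  shows "keys (single \<nu> 1 * p) = (\<lambda>\<mu>. \<nu> + \<mu>) ` keys p"
  using keys_single_mult_subset[of \<nu> 1 p] by (auto simp: in_keys_iff lookup_single_mult)

section \<open>Variables, divisibility by their powers, and the ideals these generate\<close>

definition tvar :: "nat \<Rightarrow> 'k::comm_semiring_1 mpol" where
  "tvar i = single (single i 1) 1"

lemma tvar_power: "tvar i ^ N = single (single i N) 1"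
  by (induction N) (simp_all add: tvar_def mult_single single_add[symmetric])

lemma tvar_nonzero [simp]: "tvar i \<noteq> (0 :: 'k::comm_semiring_1 mpol)"
  by (simp add: tvar_def flip: keys_eq_empty)

lemma single_lookup_minus_add:
  fixes \<mu> :: "nat \<Rightarrow>\<^sub>0 nat"
  assumes "N \<le> lookup \<mu> i"
  shows "single i N + (\<mu> - single i N) = \<mu>"
  by (rule poly_mapping_eqI) (use assms in \<open>auto simp: lookup_add lookup_minus lookup_single when_def\<close>)

lemma tvar_power_dvd_iff:
  fixes p :: "'k::comm_semiring_1 mpol"
  shows "tvar i ^ N dvd p \<longleftrightarrow> (\<forall>\<mu>\<in>keys p. N \<le> lookup \<mu> i)"
proof
  assume "tvar i ^ N dvd p"
  then show "\<forall>\<mu>\<in>keys p. N \<le> lookup \<mu> i"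
    by (auto simp: tvar_power keys_single_1_mult lookup_add elim!: dvdE)
next
  assume N: "\<forall>\<mu>\<in>keys p. N \<le> lookup \<mu> i"
  show "tvar i ^ N dvd p"
  proof (induction p rule: poly_mapping_add_single_induct)
    case (add \<mu> c q)
    have "single \<mu> c = tvar i ^ N * single (\<mu> - single i N) c"
      using add.hyps N by (simp add: tvar_power mult_single single_lookup_minus_add)
    then show ?case using add.IH by (auto intro!: dvd_add)
  qed simp
qed

lemma tvar_dvd_iff:
  fixes p :: "'k::comm_semiring_1 mpol"
  shows "tvar i dvd p \<longleftrightarrow> (\<forall>\<mu>\<in>keys p. lookup \<mu> i \<noteq> 0)"
  using tvar_power_dvd_iff[of i 1 p] by (auto simp: Suc_le_eq)

text \<open>Powers of distinct variables are coprime, as multiplication by one does not change the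
  exponent of the other. This is the tool for gluing: a fraction that admits a power of t_i and also
  a power of t_j as denominator is a polynomial.\<close>

lemma tvar_power_dvd_tvar_power_mult:
  fixes p :: "'k::comm_semiring_1 mpol"
  assumes "i \<noteq> j" "tvar i ^ N dvd tvar j ^ M * p"
  shows "tvar i ^ N dvd p"
  using assms by (auto simp: tvar_power_dvd_iff tvar_power[of j] keys_single_1_mult lookup_add lookup_single)

text \<open>The ideal generated by the \<open>tvar i ^ N i\<close> with \<open>i < j\<close>. It is
  given by its monomials so that membership is a condition on exponents.\<close>

definition power_ideal :: "(nat \<Rightarrow> nat) \<Rightarrow> nat \<Rightarrow> 'k::comm_ring_1 mpol set" where
  "power_ideal N j = {p. \<forall>\<mu>\<in>keys p. \<exists>i<j. N i \<le> lookup \<mu> i}"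

lemma power_ideal_0 [simp]: "power_ideal N 0 = {0}"
  by (auto simp: power_ideal_def)

lemma is_ideal_power_ideal: "is_ideal (power_ideal N j :: 'k::comm_ring_1 mpol set)"
  unfolding is_ideal_def power_ideal_def
proof (intro conjI allI ballI; clarsimp)
  fix x y :: "'k mpol" and \<mu>
  assume "\<forall>\<mu>\<in>keys x. \<exists>i<j. N i \<le> lookup \<mu> i" "\<forall>\<mu>\<in>keys y. \<exists>i<j. N i \<le> lookup \<mu> i"
    "\<mu> \<in> keys (x + y)"
  then show "\<exists>i<j. N i \<le> lookup \<mu> i" using keys_add[of x y] by blast
next
  fix r x :: "'k mpol" and \<mu>
  assume "\<forall>\<mu>\<in>keys x. \<exists>i<j. N i \<le> lookup \<mu> i" "\<mu> \<in> keys (r * x)"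
  then obtain a b i where "\<mu> = a + b" "i < j" "N i \<le> lookup b i"
    using keys_mult[of r x] by blast
  then show "\<exists>i<j. N i \<le> lookup \<mu> i" by (auto simp: lookup_add intro!: exI[of _ i])
qed

lemma power_ideal_Suc_add:
  assumes "u \<in> power_ideal N j"
  shows "u + tvar j ^ N j * v \<in> power_ideal N (Suc j)"
proof (rule is_ideal_add[OF is_ideal_power_ideal])
  show "u \<in> power_ideal N (Suc j)" using assms by (auto simp: power_ideal_def less_Suc_eq)
  show "tvar j ^ N j * v \<in> power_ideal N (Suc j)"
    by (auto simp: power_ideal_def tvar_power keys_single_1_mult lookup_add)
qed

lemma power_ideal_Suc_split:
  fixes p :: "'k::comm_ring_1 mpol"
  assumes "p \<in> power_ideal N (Suc j)"
  shows "\<exists>u\<in>power_ideal N j. \<exists>v. p = u + tvar j ^ N j * v"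
proof (induction p rule: poly_mapping_add_single_induct)
  case zero
  show ?case by (intro bexI[of _ 0] exI[of _ 0]) (auto simp: power_ideal_def)
next
  case (add \<mu> c q)
  from add.IH obtain u v where uv: "u \<in> power_ideal N j" "q = u + tvar j ^ N j * v" by blast
  show ?case
  proof (cases "N j \<le> lookup \<mu> j")
    case True
    have "single \<mu> c = tvar j ^ N j * single (\<mu> - single j (N j)) c"
      using True by (simp add: tvar_power mult_single single_lookup_minus_add)
    then show ?thesis using uv
      by (intro bexI[of _ u] exI[of _ "v + single (\<mu> - single j (N j)) c"]) (simp_all add: algebra_simps)
  next
    case False
    then have "single \<mu> c \<in> power_ideal N j"
      using add.hyps assms by (auto simp: power_ideal_def less_Suc_eq)
    then show ?thesis using uv
      by (intro bexI[of _ "single \<mu> c + u"] exI[of _ v])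
         (simp_all add: algebra_simps is_ideal_add[OF is_ideal_power_ideal])
  qed
qed

text \<open>Multiplication by a power of t_j changes only the exponent of t_j, while membership
  concerns the exponents of t_i for \<open>i < j\<close>.\<close>

lemma power_ideal_regular:
  assumes "tvar j ^ N j * v \<in> power_ideal N j"
  shows "v \<in> power_ideal N j"
  unfolding power_ideal_def
proof (intro CollectI ballI)
  fix \<mu> assume "\<mu> \<in> keys v"
  then have "single j (N j) + \<mu> \<in> keys (tvar j ^ N j * v)" by (simp add: tvar_power keys_single_1_mult)
  then show "\<exists>i<j. N i \<le> lookup \<mu> i"
    using assms by (force simp: power_ideal_def lookup_add lookup_single when_def)
qed

text \<open>The number of variables is encoded by a subring, so that the Nullstellensatz can be
  proved by induction on \<open>v\<close>.\<close>

definition polys_below :: "nat \<Rightarrow> 'k::zero mpol set" where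
  "polys_below v = {p. \<forall>\<mu>\<in>keys p. keys \<mu> \<subseteq> {..<v}}"

lemma polys_below_zero [simp]: "0 \<in> polys_below v"
  and polys_below_one [simp]: "1 \<in> (polys_below v :: 'k::comm_semiring_1 mpol set)"
  and polys_below_const [simp]: "const_pol c \<in> polys_below v"
  by (auto simp: polys_below_def const_pol_def)

lemma polys_below_add:
  "p \<in> polys_below v \<Longrightarrow> q \<in> polys_below v \<Longrightarrow> p + q \<in> polys_below v"
  using keys_add[of p q] unfolding polys_below_def by blast

lemma polys_below_mult:
  fixes p q :: "'k::comm_semiring_1 mpol"
  assumes "p \<in> polys_below v" "q \<in> polys_below v"
  shows "p * q \<in> polys_below v"
  unfolding polys_below_def
proof (intro CollectI ballI)
  fix \<mu> assume "\<mu> \<in> keys (p * q)"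
  then obtain a b where "a \<in> keys p" "b \<in> keys q" "\<mu> = a + b" using keys_mult[of p q] by blast
  then show "keys \<mu> \<subseteq> {..<v}" using assms keys_add[of a b] unfolding polys_below_def by blast
qed

lemma polys_below_uminus:
  fixes p :: "'k::comm_ring_1 mpol"
  shows "p \<in> polys_below v \<Longrightarrow> - p \<in> polys_below v"
  by (simp add: polys_below_def in_keys_iff)

lemma polys_below_diff:
  fixes p :: "'k::comm_ring_1 mpol"
  shows "p \<in> polys_below v \<Longrightarrow> q \<in> polys_below v \<Longrightarrow> p - q \<in> polys_below v"
  using polys_below_add[of p v "- q"] polys_below_uminus[of q v] by simp

lemma polys_below_sum:
  "(\<And>a. a \<in> S \<Longrightarrow> g a \<in> polys_below v) \<Longrightarrow> sum g S \<in> polys_below v"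
  by (induction S rule: infinite_finite_induct) (auto intro: polys_below_add)

lemma polys_below_power:
  fixes p :: "'k::comm_semiring_1 mpol"
  shows "p \<in> polys_below v \<Longrightarrow> p ^ N \<in> polys_below v"
  by (induction N) (auto intro: polys_below_mult)

lemma polys_below_mono: "v \<le> w \<Longrightarrow> p \<in> polys_below v \<Longrightarrow> p \<in> polys_below w"
  unfolding polys_below_def by fastforce

lemma tvar_in_polys_below: "i < v \<Longrightarrow> tvar i \<in> polys_below v"
  by (auto simp: polys_below_def tvar_def)

text \<open>
  The first argument of \<open>polys_below\<close> and \<open>hcomp\<close> is the number of variables, that of \<open>homogeneous\<close>
  the index of the last one.
\<close>

definition hcomp :: "nat \<Rightarrow> nat \<Rightarrow> 'k::zero mpol \<Rightarrow> 'k mpol" where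
  "hcomp v q p = Poly_Mapping.mapp
     (\<lambda>\<mu> c. c when keys \<mu> \<subseteq> {..<v} \<and> (\<Sum>i<v. lookup \<mu> i) = q) p"

lemma lookup_hcomp:
  "lookup (hcomp v q p) \<mu> = (lookup p \<mu> when keys \<mu> \<subseteq> {..<v} \<and> (\<Sum>i<v. lookup \<mu> i) = q)"
  by (simp add: hcomp_def lookup_mapp when_def in_keys_iff)

lemma keys_hcomp:
  "keys (hcomp v q p) = {\<mu>\<in>keys p. keys \<mu> \<subseteq> {..<v} \<and> (\<Sum>i<v. lookup \<mu> i) = q}"
  by (simp add: set_eq_iff in_keys_iff[of _ "hcomp v q p"] in_keys_iff[of _ p] lookup_hcomp conj_commute)

lemma hcomp_zero [simp]: "hcomp v q 0 = 0"
  by (rule poly_mapping_eqI) (simp add: lookup_hcomp)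

lemma hcomp_add: "hcomp v q (p + p') = hcomp v q p + hcomp v q p'"
  by (rule poly_mapping_eqI) (simp add: lookup_hcomp lookup_add when_def)

lemma hcomp_diff: "hcomp v q (p - p' :: 'k::comm_ring_1 mpol) = hcomp v q p - hcomp v q p'"
  by (rule poly_mapping_eqI) (simp add: lookup_hcomp lookup_minus when_def)

lemma hcomp_sum: "hcomp v q (sum g S) = (\<Sum>a\<in>S. hcomp v q (g a))"
  by (induction S rule: infinite_finite_induct) (simp_all add: hcomp_add)

lemma hcomp_Suc:
  assumes "p \<in> polys_below v"
  shows "hcomp (Suc v) q p = hcomp v q p"
proof (rule poly_mapping_eqI)
  fix \<mu>
  show "lookup (hcomp (Suc v) q p) \<mu> = lookup (hcomp v q p) \<mu>"
  proof (cases "\<mu> \<in> keys p")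
    case True
    then have sub: "keys \<mu> \<subseteq> {..<v}" using assms by (auto simp: polys_below_def)
    then have "lookup \<mu> v = 0" "keys \<mu> \<subseteq> {..<Suc v}" by (auto simp: in_keys_iff subset_iff less_Suc_eq)
    then show ?thesis using sub by (simp add: lookup_hcomp)
  qed (simp add: lookup_hcomp in_keys_iff)
qed

lemma homogeneous_hcomp [simp]: "homogeneous n q (hcomp (Suc n) q p)"
  by (auto simp: homogeneous_def keys_hcomp lessThan_Suc_atMost)

lemma homogeneous_iff_hcomp: "homogeneous n q p \<longleftrightarrow> hcomp (Suc n) q p = p"
proof
  assume "homogeneous n q p"
  then show "hcomp (Suc n) q p = p"
    by (intro poly_mapping_eqI)
       (auto simp: homogeneous_def lookup_hcomp lessThan_Suc_atMost when_def in_keys_iff)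
next
  assume "hcomp (Suc n) q p = p"
  then show "homogeneous n q p" by (metis homogeneous_hcomp)
qed

lemma homogeneous_zero [simp]: "homogeneous n q 0"
  and homogeneous_const [simp]: "homogeneous n 0 (const_pol c)"
  and homogeneous_one [simp]: "homogeneous n 0 (1 :: 'k::comm_semiring_1 mpol)"
  by (auto simp: homogeneous_def const_pol_def)

lemma homogeneous_add: "homogeneous n q p \<Longrightarrow> homogeneous n q p' \<Longrightarrow> homogeneous n q (p + p')"
  by (simp add: homogeneous_iff_hcomp hcomp_add)

lemma homogeneous_sum:
  "(\<And>a. a \<in> S \<Longrightarrow> homogeneous n q (g a)) \<Longrightarrow> homogeneous n q (sum g S)"
  by (induction S rule: infinite_finite_induct) (auto intro: homogeneous_add)

lemma homogeneous_polys_below: "homogeneous n q p \<Longrightarrow> p \<in> polys_below (Suc n)"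
  by (auto simp: homogeneous_def polys_below_def lessThan_Suc_atMost)

lemma homogeneous_mult:
  fixes p p' :: "'k::comm_semiring_1 mpol"
  assumes "homogeneous n q p" "homogeneous n q' p'"
  shows "homogeneous n (q + q') (p * p')"
  unfolding homogeneous_def
proof (intro ballI)
  fix \<mu> assume "\<mu> \<in> keys (p * p')"
  then obtain a b where "a \<in> keys p" "b \<in> keys p'" "\<mu> = a + b" using keys_mult[of p p'] by blast
  then show "keys \<mu> \<subseteq> {..n} \<and> (\<Sum>i\<le>n. lookup \<mu> i) = q + q'"
    using assms keys_add[of a b] unfolding homogeneous_def
    by (simp add: lookup_add sum.distrib) blast
qed

lemma homogeneous_tvar: "i \<le> n \<Longrightarrow> homogeneous n 1 (tvar i)"
  by (auto simp: homogeneous_def tvar_def lookup_single when_def)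

lemma homogeneous_power:
  fixes p :: "'k::comm_semiring_1 mpol"
  shows "homogeneous n q p \<Longrightarrow> homogeneous n (N * q) (p ^ N)"
  by (induction N) (auto intro: homogeneous_mult)

lemma homogeneous_tvar_power: "i \<le> n \<Longrightarrow> homogeneous n N (tvar i ^ N)"
  using homogeneous_power[OF homogeneous_tvar, of i n N] by simp

text \<open>Also for \<open>p\<close> with variables beyond \<open>t\<^sub>n\<close>: their monomials drop out on both sides.\<close>

lemma hcomp_mult_homogeneous:
  fixes f p :: "'k::comm_semiring_1 mpol"
  assumes f: "homogeneous n D f"
  shows "hcomp (Suc n) (D + q) (f * p) = f * hcomp (Suc n) q p"
proof (induction p rule: poly_mapping_add_single_induct)
  case (add \<mu> c p')
  have "hcomp (Suc n) (D + q) (f * single \<mu> c) = f * hcomp (Suc n) q (single \<mu> c)"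
  proof (cases "keys \<mu> \<subseteq> {..n} \<and> (\<Sum>i\<le>n. lookup \<mu> i) = q")
    case True
    then have "homogeneous n q (single \<mu> c)" by (auto simp: homogeneous_def)
    moreover from this have "homogeneous n (D + q) (f * single \<mu> c)" by (rule homogeneous_mult[OF f])
    ultimately show ?thesis by (simp add: homogeneous_iff_hcomp)
  next
    case False
    have "hcomp (Suc n) q (single \<mu> c) = 0"
      using False by (intro poly_mapping_eqI)
        (auto simp: lookup_hcomp lookup_single when_def lessThan_Suc_atMost)
    moreover have "hcomp (Suc n) (D + q) (f * single \<mu> c) = 0"
    proof (rule ccontr)
      assume "hcomp (Suc n) (D + q) (f * single \<mu> c) \<noteq> 0"
      then obtain \<nu> where \<nu>: "\<nu> \<in> keys (f * single \<mu> c)" "keys \<nu> \<subseteq> {..n}" "(\<Sum>i\<le>n. lookup \<nu> i) = D + q"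
        unfolding keys_eq_empty[symmetric] keys_hcomp lessThan_Suc_atMost by blast
      then obtain a where a: "a \<in> keys f" "\<nu> = a + \<mu>"
        using keys_mult[of f "single \<mu> c"] by (auto split: if_splits)
      then have "(\<Sum>i\<le>n. lookup \<mu> i) = q"
        using f \<nu>(3) by (simp add: homogeneous_def lookup_add sum.distrib)
      moreover have "keys \<mu> \<subseteq> {..n}" using \<nu>(2) unfolding a(2) by (auto simp: in_keys_iff lookup_add subset_iff)
      ultimately show False using False by blast
    qed
    ultimately show ?thesis by simp
  qed
  then show ?case by (simp add: hcomp_add distrib_left add)
qed simp

lemma hcomp_mult_homogeneous_small:
  fixes f p :: "'k::comm_semiring_1 mpol"
  assumes f: "homogeneous n D f" "q < D"
  shows "hcomp (Suc n) q (f * p) = 0"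
proof (rule ccontr)
  assume "hcomp (Suc n) q (f * p) \<noteq> 0"
  then obtain \<nu> where \<nu>: "\<nu> \<in> keys (f * p)" "(\<Sum>i\<le>n. lookup \<nu> i) = q"
    unfolding keys_eq_empty[symmetric] keys_hcomp lessThan_Suc_atMost by blast
  then obtain a b where "a \<in> keys f" "\<nu> = a + b"
    using keys_mult[of f p] by blast
  then show False using f \<nu>(2) by (auto simp: homogeneous_def lookup_add sum.distrib)
qed

lemma homogeneous_tvar_power_mult_cancel:
  fixes p :: "'k::comm_ring_1 mpol"
  assumes "homogeneous n (N + q) (tvar i ^ N * p)" "i \<le> n"
  shows "homogeneous n q p"
  unfolding homogeneous_def
proof (intro ballI)
  fix \<mu> assume "\<mu> \<in> keys p"
  then have "single i N + \<mu> \<in> keys (tvar i ^ N * p)" by (simp add: tvar_power keys_single_1_mult)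
  then have "keys (single i N + \<mu>) \<subseteq> {..n}" "(\<Sum>l\<le>n. lookup (single i N + \<mu>) l) = N + q"
    using assms(1) unfolding homogeneous_def by blast+
  moreover have "(\<Sum>l\<le>n. lookup (single i N) l) = N" using assms(2) by (simp add: lookup_single when_def)
  ultimately show "keys \<mu> \<subseteq> {..n} \<and> (\<Sum>l\<le>n. lookup \<mu> l) = q"
    by (auto simp: lookup_add sum.distrib in_keys_iff subset_iff)
qed

lemma sum_hcomp:
  assumes "p \<in> polys_below v"
  shows "p = (\<Sum>q\<in>(\<lambda>\<mu>. \<Sum>i<v. lookup \<mu> i) ` keys p. hcomp v q p)"
proof (rule poly_mapping_eqI)
  fix \<mu>
  show "lookup p \<mu> = lookup (\<Sum>q\<in>(\<lambda>\<mu>. \<Sum>i<v. lookup \<mu> i) ` keys p. hcomp v q p) \<mu>"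
  proof (cases "\<mu> \<in> keys p")
    case True
    then show ?thesis using assms by (simp add: lookup_sum lookup_hcomp when_def polys_below_def)
  qed (simp add: lookup_sum lookup_hcomp in_keys_iff)
qed

section \<open>Evaluation at points\<close>

definition eval_monom :: "(nat \<Rightarrow> 'k::comm_semiring_1) \<Rightarrow> (nat \<Rightarrow>\<^sub>0 nat) \<Rightarrow> 'k" where
  "eval_monom a \<mu> = (\<Prod>i\<in>keys \<mu>. a i ^ lookup \<mu> i)"

lemma eval_monom_superset:
  "finite S \<Longrightarrow> keys \<mu> \<subseteq> S \<Longrightarrow> eval_monom a \<mu> = (\<Prod>i\<in>S. a i ^ lookup \<mu> i)"
  unfolding eval_monom_def by (rule prod.mono_neutral_left) (auto simp: in_keys_iff)

lemma eval_monom_add: "eval_monom a (\<mu> + \<nu>) = eval_monom a \<mu> * eval_monom a \<nu>"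
proof -
  have S: "finite (keys \<mu> \<union> keys \<nu>)" by simp
  show ?thesis
    using keys_add[of \<mu> \<nu>]
    by (simp add: eval_monom_superset[OF S] lookup_add power_add prod.distrib)
qed

lemma eval_pol_superset:
  "finite S \<Longrightarrow> keys p \<subseteq> S \<Longrightarrow> eval_pol a p = (\<Sum>\<mu>\<in>S. lookup p \<mu> * eval_monom a \<mu>)"
  unfolding eval_pol_def eval_monom_def
  by (rule sum.mono_neutral_left) (auto simp: in_keys_iff)

lemma eval_pol_zero [simp]: "eval_pol a 0 = 0"
  by (simp add: eval_pol_def)

lemma eval_pol_add [simp]: "eval_pol a (p + q) = eval_pol a p + eval_pol a q"
proof -
  have S: "finite (keys p \<union> keys q)" by simp
  show ?thesis
    using keys_add[of p q]
    by (simp add: eval_pol_superset[OF S] lookup_add distrib_right sum.distrib)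
qed

lemma eval_pol_single: "eval_pol a (single \<mu> c) = c * eval_monom a \<mu>"
  by (simp add: eval_pol_def eval_monom_def)

lemma eval_pol_mult [simp]: "eval_pol a (p * q) = eval_pol a p * eval_pol a q"
proof (induction p rule: poly_mapping_add_single_induct)
  case (add \<mu> c p)
  have "eval_pol a (single \<mu> c * q) = eval_pol a (single \<mu> c) * eval_pol a q"
    by (induction q rule: poly_mapping_add_single_induct)
       (simp_all add: distrib_left mult_single eval_pol_single eval_monom_add ac_simps)
  then show ?case by (simp add: distrib_right add)
qed simp

lemma eval_pol_uminus [simp]: "eval_pol a (- p) = - eval_pol a (p :: 'k::comm_ring_1 mpol)"
  using eval_pol_add[of a p "- p"] by (simp add: eq_neg_iff_add_eq_0 add.commute)

lemma eval_pol_diff [simp]: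
  "eval_pol a (p - q) = eval_pol a p - eval_pol a (q :: 'k::comm_ring_1 mpol)"
  using eval_pol_add[of a p "- q"] by simp

lemma eval_pol_one [simp]: "eval_pol a 1 = 1"
  using eval_pol_single[of a 0 1] by (simp add: eval_monom_def)

lemma eval_pol_const [simp]: "eval_pol a (const_pol c) = c"
  by (simp add: const_pol_def eval_pol_single eval_monom_def)

lemma eval_pol_tvar [simp]: "eval_pol a (tvar i) = a i"
  by (simp add: tvar_def eval_pol_single eval_monom_def)

lemma eval_pol_sum: "eval_pol a (sum g S) = (\<Sum>s\<in>S. eval_pol a (g s))"
  by (induction S rule: infinite_finite_induct) simp_all

lemma eval_pol_of_nat [simp]: "eval_pol a (of_nat N) = of_nat N"
  by (induction N) simp_all

lemma eval_pol_cong: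
  assumes "p \<in> polys_below v" "\<And>i. i < v \<Longrightarrow> a i = b i"
  shows "eval_pol a p = eval_pol b p"
  unfolding eval_pol_def
proof (intro sum.cong refl arg_cong2[where f = "(*)"] prod.cong)
  fix \<mu> i assume "\<mu> \<in> keys p" "i \<in> keys \<mu>"
  then have "i < v" using assms(1) by (auto simp: polys_below_def)
  then show "a i ^ lookup \<mu> i = b i ^ lookup \<mu> i" by (simp add: assms(2))
qed

lemma eval_pol_homogeneous_scale:
  assumes "homogeneous n q p"
  shows "eval_pol (\<lambda>i. c * a i) p = c ^ q * eval_pol a p"
proof -
  have "eval_monom (\<lambda>i. c * a i) \<mu> = c ^ q * eval_monom a \<mu>" if "\<mu> \<in> keys p" for \<mu>
  proof -
    have sub: "keys \<mu> \<subseteq> {..n}" and q: "q = (\<Sum>i\<le>n. lookup \<mu> i)" 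
      using assms that by (auto simp: homogeneous_def)
    show ?thesis
      by (simp add: eval_monom_superset[OF _ sub] q power_mult_distrib prod.distrib power_sum)
  qed
  then show ?thesis
    by (simp add: eval_pol_def eval_monom_def[symmetric] sum_distrib_left ac_simps)
qed

section \<open>The projective Nullstellensatz\<close>

text \<open>Polynomials in t_0, ..., t_v are treated as univariate ones over the polynomials in the
  first \<open>v\<close> variables; substituting \<open>tvar v\<close>, as in
  \<open>poly q (tvar v)\<close>, leads back.\<close>

definition coeffs_below :: "nat \<Rightarrow> 'k::zero mpol poly \<Rightarrow> bool" where
  "coeffs_below v q \<longleftrightarrow> (\<forall>i. coeff q i \<in> polys_below v)"

lemma coeffs_below_add: "coeffs_below v p \<Longrightarrow> coeffs_below v q \<Longrightarrow> coeffs_below v (p + q)"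
  by (simp add: coeffs_below_def polys_below_add)

lemma coeffs_below_diff:
  "coeffs_below v (p :: 'k::comm_ring_1 mpol poly) \<Longrightarrow> coeffs_below v q \<Longrightarrow> coeffs_below v (p - q)"
  by (simp add: coeffs_below_def polys_below_diff)

lemma coeffs_below_mult:
  "coeffs_below v (p :: 'k::comm_semiring_1 mpol poly) \<Longrightarrow> coeffs_below v q \<Longrightarrow> coeffs_below v (p * q)"
  by (auto simp: coeffs_below_def coeff_mult intro!: polys_below_sum polys_below_mult)

lemma coeffs_below_monom: "c \<in> polys_below v \<Longrightarrow> coeffs_below v (monom c i)"
  by (simp add: coeffs_below_def)

lemma coeffs_below_smult:
  "c \<in> polys_below v \<Longrightarrow> coeffs_below v (p :: 'k::comm_semiring_1 mpol poly) \<Longrightarrow> coeffs_below v (smult c p)"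
  by (simp add: coeffs_below_def polys_below_mult)

lemma coeffs_below_pCons:
  "coeffs_below v (pCons c q) \<longleftrightarrow> c \<in> polys_below v \<and> coeffs_below v q"
  by (auto simp: coeffs_below_def coeff_pCons split: nat.splits)

lemma poly_tvar_in_polys_below:
  "coeffs_below v (q :: 'k::comm_semiring_1 mpol poly) \<Longrightarrow> poly q (tvar v) \<in> polys_below (Suc v)"
  unfolding poly_altdef coeffs_below_def
  by (intro polys_below_sum polys_below_mult polys_below_power)
     (auto intro: tvar_in_polys_below polys_below_mono[of v "Suc v"])

abbreviation eval_coeffs :: "(nat \<Rightarrow> 'k) \<Rightarrow> 'k::comm_semiring_1 mpol poly \<Rightarrow> 'k poly" where
  "eval_coeffs a \<equiv> map_poly (eval_pol a)"

lemma eval_coeffs_add [simp]: "eval_coeffs a (p + q) = eval_coeffs a p + eval_coeffs a q"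
  by (rule poly_eqI) (simp add: coeff_map_poly)

lemma eval_coeffs_diff [simp]:
  "eval_coeffs a (p - q) = eval_coeffs a p - eval_coeffs a (q :: 'k::comm_ring_1 mpol poly)"
  by (rule poly_eqI) (simp add: coeff_map_poly)

lemma eval_coeffs_mult [simp]: "eval_coeffs a (p * q) = eval_coeffs a p * eval_coeffs a q"
  by (rule poly_eqI) (simp add: coeff_map_poly coeff_mult eval_pol_sum)

lemma eval_coeffs_smult [simp]: "eval_coeffs a (smult c q) = smult (eval_pol a c) (eval_coeffs a q)"
  by (rule poly_eqI) (simp add: coeff_map_poly)

lemma eval_coeffs_monom [simp]: "eval_coeffs a (monom c i) = monom (eval_pol a c) i"
  by (rule poly_eqI) (simp add: coeff_map_poly)

lemma eval_poly_tvar: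
  "coeffs_below v q \<Longrightarrow>
    eval_pol (a(v := b)) (poly q (tvar v)) = poly (eval_coeffs a q) b"
proof (induction q)
  case (pCons c q)
  define a' where "a' = a(v := b)"
  have "eval_pol a' c = eval_pol a c"
    using pCons.prems by (intro eval_pol_cong[of _ v]) (auto simp: coeffs_below_pCons a'_def)
  moreover have "a' v = b" by (simp add: a'_def)
  ultimately show ?case
    using pCons unfolding a'_def[symmetric] by (simp add: map_poly_pCons coeffs_below_pCons)
qed simp

text \<open>The degree bound \<open>D\<close> is part of the conclusion so that adding the monomial
  of degree \<open>D\<close> yields a monic polynomial in t_v.\<close>

lemma polys_below_Suc_as_poly:
  fixes p :: "'k::comm_semiring_1 mpol"
  assumes p: "p \<in> polys_below (Suc v)" "\<And>\<mu>. \<mu> \<in> keys p \<Longrightarrow> lookup \<mu> v < D"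
  obtains q where "coeffs_below v q" "\<And>i. D \<le> i \<Longrightarrow> coeff q i = 0" "poly q (tvar v) = p"
proof -
  have "\<exists>q. coeffs_below v q \<and> (\<forall>i\<ge>D. coeff q i = 0) \<and> poly q (tvar v) = p"
  proof (induction p rule: poly_mapping_add_single_induct)
    case zero
    show ?case by (intro exI[of _ 0]) (simp add: coeffs_below_def)
  next
    case (add \<mu> c p')
    then obtain q where q: "coeffs_below v q" "\<forall>i\<ge>D. coeff q i = 0" "poly q (tvar v) = p'" by blast
    define \<nu> where "\<nu> = \<mu> - single v (lookup \<mu> v)"
    have \<mu>: "single v (lookup \<mu> v) + \<nu> = \<mu>"
      unfolding \<nu>_def by (rule single_lookup_minus_add) simp
    have "i < v" if "i \<in> keys \<nu>" for i
    proof -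
      have "i \<noteq> v" "i \<in> keys \<mu>" using that by (auto simp: \<nu>_def in_keys_iff lookup_minus)
      then show ?thesis using p(1) add.hyps by (force simp: polys_below_def)
    qed
    then have "single \<nu> c \<in> polys_below v" by (auto simp: polys_below_def)
    then have "coeffs_below v (monom (single \<nu> c) (lookup \<mu> v) + q)"
      by (intro coeffs_below_add coeffs_below_monom q)
    moreover have "lookup \<mu> v < D" using p(2) add.hyps by blast
    moreover have "poly (monom (single \<nu> c) (lookup \<mu> v)) (tvar v) = single \<mu> c"
      by (simp add: poly_monom tvar_power mult_single add.commute[of \<nu>] \<mu>)
    ultimately show ?case using q
      by (intro exI[of _ "monom (single \<nu> c) (lookup \<mu> v) + q"]) auto
  qed
  then show ?thesis using that by blast
qed

text \<open>Division with remainder by the monic \<open>\<gamma>\<close> of degree \<open>D\<close>.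
  Each step removes the coefficient in degree \<open>D + B\<close> by ring operations only, so no
  denominators arise and the coefficients stay in the first \<open>v\<close> variables.\<close>

lemma coeffs_below_reduce:
  fixes \<gamma> :: "'k::comm_ring_1 mpol poly"
  assumes \<gamma>: "coeffs_below v \<gamma>" "coeff \<gamma> D = 1" "\<And>i. D < i \<Longrightarrow> coeff \<gamma> i = 0"
    and p: "coeffs_below v p"
  obtains p' s where "coeffs_below v p'" "coeffs_below v s" "p = p' + s * \<gamma>"
    "\<And>i. D \<le> i \<Longrightarrow> coeff p' i = 0"
proof -
  have "\<exists>p' s. coeffs_below v p' \<and> coeffs_below v s \<and> p = p' + s * \<gamma> \<and> (\<forall>i\<ge>D. coeff p' i = 0)"
    if "\<forall>i\<ge>D + B. coeff p i = 0" for B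
    using that p
  proof (induction B arbitrary: p)
    case 0
    then show ?case by (intro exI[of _ p] exI[of _ 0]) (auto simp: coeffs_below_def)
  next
    case (Suc B)
    define c where "c = coeff p (D + B)"
    have c: "coeffs_below v (monom c B)"
      using Suc.prems by (intro coeffs_below_monom) (simp add: c_def coeffs_below_def)
    have "coeff (p - monom c B * \<gamma>) i = 0" if "i \<ge> D + B" for i
    proof (cases "i = D + B")
      case True
      then show ?thesis using \<gamma>(2) by (simp add: coeff_monom_mult c_def)
    next
      case False
      then show ?thesis using that Suc.prems(1) \<gamma>(3)[of "i - B"] by (simp add: coeff_monom_mult)
    qed
    moreover have "coeffs_below v (p - monom c B * \<gamma>)"
      by (intro coeffs_below_diff coeffs_below_mult c \<gamma> Suc.prems)
    ultimately obtain p' s where s: "coeffs_below v p'" "coeffs_below v s"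
      "p - monom c B * \<gamma> = p' + s * \<gamma>" "\<forall>i\<ge>D. coeff p' i = 0"
      using Suc.IH by blast
    then show ?case
      by (intro exI[of _ p'] exI[of _ "s + monom c B"])
         (auto simp: algebra_simps intro: coeffs_below_add c)
  qed
  moreover have "\<forall>i\<ge>D + Suc (degree p). coeff p i = 0" by (auto intro: coeff_eq_0)
  ultimately show ?thesis using that by blast
qed

section \<open>Graded ideals and their radicals\<close>

definition graded_ideal :: "nat \<Rightarrow> 'k::comm_ring_1 mpol set \<Rightarrow> bool" where
  "graded_ideal v I \<longleftrightarrow> I \<subseteq> polys_below v \<and> 0 \<in> I \<and> (\<forall>p\<in>I. \<forall>q\<in>I. p + q \<in> I) \<and>
     (\<forall>p\<in>polys_below v. \<forall>q\<in>I. p * q \<in> I) \<and> (\<forall>p\<in>I. \<forall>q. hcomp v q p \<in> I)"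

context
  fixes v and I :: "'k::comm_ring_1 mpol set"
  assumes I: "graded_ideal v I"
begin

lemma graded_ideal_subset: "p \<in> I \<Longrightarrow> p \<in> polys_below v"
  and graded_ideal_zero: "0 \<in> I"
  and graded_ideal_add: "p \<in> I \<Longrightarrow> q \<in> I \<Longrightarrow> p + q \<in> I"
  and graded_ideal_mult: "p \<in> polys_below v \<Longrightarrow> q \<in> I \<Longrightarrow> p * q \<in> I"
  and graded_ideal_hcomp: "p \<in> I \<Longrightarrow> hcomp v d p \<in> I"
  using I by (auto simp: graded_ideal_def)

lemma graded_ideal_diff: "p \<in> I \<Longrightarrow> q \<in> I \<Longrightarrow> p - q \<in> I"
  using graded_ideal_add[of p "-1 * q"] graded_ideal_mult[of "-1" q] polys_below_uminus[of "1 :: 'k mpol" v]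
  by simp

lemma graded_ideal_sum: "(\<And>a. a \<in> S \<Longrightarrow> g a \<in> I) \<Longrightarrow> sum g S \<in> I"
  by (induction S rule: infinite_finite_induct) (auto simp: graded_ideal_zero graded_ideal_add)

text \<open>In every term of the binomial expansion either the exponent of \<open>x\<close> is at
  least \<open>M\<close> or that of \<open>y\<close> is at least \<open>N\<close>.\<close>

lemma graded_ideal_radical_add:
  assumes xy: "x \<in> polys_below v" "y \<in> polys_below v" and "x ^ M \<in> I" "y ^ N \<in> I"
  shows "(x + y) ^ (M + N) \<in> I"
  unfolding binomial_ring
proof (rule graded_ideal_sum)
  fix k assume k: "k \<in> {..M + N}"
  have nat: "of_nat i \<in> (polys_below v :: 'k mpol set)" for i
    by (induction i) (auto intro: polys_below_add)
  show "of_nat (M + N choose k) * x ^ k * y ^ (M + N - k) \<in> I"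
  proof (cases "M \<le> k")
    case True
    then have "x ^ k = x ^ (k - M) * x ^ M" by (simp flip: power_add)
    then have "of_nat (M + N choose k) * x ^ k * y ^ (M + N - k) =
        (of_nat (M + N choose k) * x ^ (k - M) * y ^ (M + N - k)) * x ^ M"
      by (simp add: ac_simps)
    then show ?thesis using assms
      by (auto intro!: graded_ideal_mult polys_below_mult polys_below_power nat)
  next
    case False
    then have "y ^ (M + N - k) = y ^ (M - k) * y ^ N" by (simp flip: power_add)
    then have "of_nat (M + N choose k) * x ^ k * y ^ (M + N - k) =
        (of_nat (M + N choose k) * x ^ k * y ^ (M - k)) * y ^ N"
      by (simp add: ac_simps)
    then show ?thesis using assms
      by (auto intro!: graded_ideal_mult polys_below_mult polys_below_power nat)
  qed
qed

text \<open>Each term of \<open>p\<close> is a multiple of some t_i with \<open>i < w\<close> and so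
  has a power in \<open>I\<close>; such elements are closed under addition.\<close>

lemma graded_ideal_radical_monomials:
  assumes N: "\<And>i. i < w \<Longrightarrow> \<exists>N. tvar i ^ N \<in> I"
    and p: "p \<in> polys_below v" "\<And>\<mu>. \<mu> \<in> keys p \<Longrightarrow> \<exists>i<w. lookup \<mu> i \<noteq> 0"
  shows "\<exists>N. p ^ N \<in> I"
proof -
  have "p \<in> polys_below v \<and> (\<exists>N. p ^ N \<in> I)"
  proof (induction p rule: poly_mapping_add_single_induct)
    case zero
    then show ?case by (auto intro!: exI[of _ 1] graded_ideal_zero)
  next
    case (add \<mu> c q)
    have s: "single \<mu> c \<in> polys_below v" using add.hyps p(1) by (auto simp: polys_below_def)
    obtain i where i: "i < w" "lookup \<mu> i \<noteq> 0" using p(2) add.hyps by blast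
    obtain N where N: "tvar i ^ N \<in> I" using N i by blast
    define \<nu> where "\<nu> = \<mu> - single i 1"
    have "keys \<nu> \<subseteq> keys \<mu>" by (auto simp: \<nu>_def in_keys_iff lookup_minus)
    then have \<nu>: "single \<nu> c \<in> polys_below v" using s add.hyps(1) by (auto simp: polys_below_def dest: subset_trans)
    have "single \<mu> c = single \<nu> c * tvar i"
      using single_lookup_minus_add[of 1 \<mu> i] i
      by (simp add: tvar_def mult_single \<nu>_def add.commute[of _ "single i (Suc 0)"])
    then have "single \<mu> c ^ N = single \<nu> c ^ N * tvar i ^ N" by (simp add: power_mult_distrib)
    then have "single \<mu> c ^ N \<in> I" using N \<nu> by (simp add: graded_ideal_mult polys_below_power)
    then show ?case using add.IH s graded_ideal_radical_add polys_below_add by blast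
  qed
  then show ?thesis ..
qed

end

text \<open>
  This takes the place of the resultant in the classical extension argument: cross-multiplication
  with the element that specialises to \<open>t\<^sub>v\<^sup>r\<close> removes the coefficients of \<open>t\<^sub>v\<^sup>r\<close> and preserves the
  other specialisations at \<open>a\<close>.
\<close>

lemma elimination_descent:
  fixes I :: "'k::comm_ring_1 mpol set"
  assumes I: "graded_ideal (Suc v) I"
    and "\<forall>i\<le>r. \<exists>h. coeffs_below v h \<and> poly h (tvar v) \<in> I \<and> (\<forall>j>r. coeff h j = 0) \<and>
           eval_coeffs a h = monom 1 i"
  shows "\<exists>c\<in>I \<inter> polys_below v. eval_pol a c = 1"
  using assms(2)
proof (induction r)
  case 0
  then obtain h where h: "coeffs_below v h" "poly h (tvar v) \<in> I" "\<forall>j>0. coeff h j = 0"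
    "eval_coeffs a h = monom 1 0" by blast
  have deg: "degree h = 0" using h(3) degree_le[of 0 h] by simp
  then have "poly h (tvar v) = coeff h 0" by (simp add: poly_altdef)
  moreover have "eval_pol a (coeff h 0) = 1"
    using arg_cong[OF h(4), of "\<lambda>p. coeff p 0"] by (simp add: coeff_map_poly)
  ultimately show ?case using h by (auto simp: coeffs_below_def)
next
  case (Suc r)
  then obtain h where h: "\<And>i. i \<le> Suc r \<Longrightarrow> coeffs_below v (h i)"
    "\<And>i. i \<le> Suc r \<Longrightarrow> poly (h i) (tvar v) \<in> I"
    "\<And>i j. i \<le> Suc r \<Longrightarrow> j > Suc r \<Longrightarrow> coeff (h i) j = 0"
    "\<And>i. i \<le> Suc r \<Longrightarrow> eval_coeffs a (h i) = monom 1 i" by metis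
  define \<alpha> where "\<alpha> i = coeff (h i) (Suc r)" for i
  have \<alpha>: "\<alpha> i \<in> polys_below v" if "i \<le> Suc r" for i
    using h(1)[OF that] by (simp add: coeffs_below_def \<alpha>_def)
  have \<alpha>_eval: "eval_pol a (\<alpha> i) = (if i = Suc r then 1 else 0)" if "i \<le> Suc r" for i
    using arg_cong[OF h(4)[OF that], of "\<lambda>p. coeff p (Suc r)"]
    by (simp add: coeff_map_poly \<alpha>_def)
  have up: "\<alpha> i \<in> polys_below (Suc v)" if "i \<le> Suc r" for i
    by (rule polys_below_mono[OF _ \<alpha>[OF that]]) simp
  show ?case
  proof (rule Suc.IH, intro allI impI)
    fix i assume i: "i \<le> r"
    define h' where "h' = smult (\<alpha> (Suc r)) (h i) - smult (\<alpha> i) (h (Suc r))"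
    have "coeffs_below v h'"
      unfolding h'_def using i by (intro coeffs_below_diff coeffs_below_smult \<alpha> h) auto
    moreover have "poly h' (tvar v) \<in> I"
      unfolding h'_def poly_diff poly_smult using i
      by (intro graded_ideal_diff[OF I] graded_ideal_mult[OF I] up h) auto
    moreover have "coeff h' j = 0" if "j > r" for j
      using h(3)[of _ j] i that by (cases "j = Suc r") (auto simp: h'_def \<alpha>_def mult.commute)
    moreover have "eval_coeffs a h' = monom 1 i"
      using i h(4) by (simp add: h'_def \<alpha>_eval)
    ultimately show "\<exists>h. coeffs_below v h \<and> poly h (tvar v) \<in> I \<and> (\<forall>j>r. coeff h j = 0) \<and>
           eval_coeffs a h = monom 1 i" by blast
  qed
qed

text \<open>A nonzero element of least degree generates the ideal. It is not constant, since 1 is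
  not in \<open>J\<close>, and any root of it is a common root.\<close>

lemma poly_ideal_common_root:
  fixes J :: "'k::alg_closed_field poly set"
  assumes add: "\<And>p q. p \<in> J \<Longrightarrow> q \<in> J \<Longrightarrow> p + q \<in> J"
    and mult: "\<And>p q. q \<in> J \<Longrightarrow> p * q \<in> J"
    and g: "g \<in> J" "g \<noteq> 0" and "1 \<notin> J"
  shows "\<exists>b. \<forall>p\<in>J. poly p b = 0"
proof -
  obtain h where h: "h \<in> J" "h \<noteq> 0" and min: "\<And>p. p \<in> J \<Longrightarrow> p \<noteq> 0 \<Longrightarrow> degree h \<le> degree p"
    using ex_has_least_nat[of "\<lambda>p. p \<in> J \<and> p \<noteq> 0" g degree] g by blast
  have "degree h > 0"
  proof (rule ccontr)
    assume "\<not> degree h > 0"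
    then obtain c where "h = [:c:]" by (auto elim: degree_eq_zeroE)
    then have "[:inverse c:] * h = 1" using h(2) by (simp add: one_pCons)
    then show False using mult[OF h(1), of "[:inverse c:]"] \<open>1 \<notin> J\<close> by simp
  qed
  then obtain b where b: "poly h b = 0" using alg_closed_imp_poly_has_root by blast
  have "poly p b = 0" if "p \<in> J" for p
  proof -
    have "p mod h = p + (- (p div h)) * h" by (simp add: minus_div_mult_eq_mod[symmetric])
    then have "p mod h \<in> J" using that h(1) add mult by metis
    then have "p mod h = 0" using min[of "p mod h"] degree_mod_less'[OF h(2), of p] by force
    then have "h dvd p" by auto
    then show ?thesis using b by auto
  qed
  then show ?thesis by blast
qed

text \<open>Specialising the elements of \<open>I\<close> at \<open>a\<close> gives an ideal
  \<open>J\<close> of univariate polynomials, nonzero because of the monic \<open>\<gamma>\<close>,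
  and a common root is the missing coordinate \<open>b\<close>. If 1 were in \<open>J\<close>,
  elimination would produce an element of \<open>I\<close> without t_v that takes the value 1 at
  \<open>a\<close>.\<close>

lemma extend_zero:
  fixes I :: "'k::alg_closed_field mpol set"
  assumes I: "graded_ideal (Suc v) I"
    and \<gamma>: "coeffs_below v \<gamma>" "coeff \<gamma> D = 1" "\<And>i. D < i \<Longrightarrow> coeff \<gamma> i = 0" "poly \<gamma> (tvar v) \<in> I"
    and a: "\<And>c. c \<in> I \<Longrightarrow> c \<in> polys_below v \<Longrightarrow> eval_pol a c = 0"
  shows "\<exists>b. \<forall>p\<in>I. eval_pol (a(v := b)) p = 0"
proof -
  define J where "J = eval_coeffs a ` {q. coeffs_below v q \<and> poly q (tvar v) \<in> I}"
  have ev\<gamma>: "coeff (eval_coeffs a \<gamma>) D = 1" "\<And>i. D < i \<Longrightarrow> coeff (eval_coeffs a \<gamma>) i = 0"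
    using \<gamma>(2,3) by (simp_all add: coeff_map_poly)
  then have ev\<gamma>0: "eval_coeffs a \<gamma> \<noteq> 0" by auto
  have deg\<gamma>: "degree (eval_coeffs a \<gamma>) = D"
    using ev\<gamma> by (intro antisym degree_le le_degree) auto
  have "1 \<notin> J"
  proof
    assume "1 \<in> J"
    then obtain f where f: "coeffs_below v f" "poly f (tvar v) \<in> I" "eval_coeffs a f = 1"
      by (auto simp: J_def)
    \<comment> \<open>Input for the elimination: the multiples of \<open>f\<close> by powers of t_v
      specialise to these powers, and reducing them modulo \<open>\<gamma>\<close> bounds the degree
      without changing the specialisation.\<close>
    have "\<exists>h. coeffs_below v h \<and> poly h (tvar v) \<in> I \<and> (\<forall>j\<ge>D. coeff h j = 0) \<and>
           eval_coeffs a h = monom 1 i" if "i < D" for i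
    proof -
      have m: "coeffs_below v (monom 1 i * f)" by (intro coeffs_below_mult coeffs_below_monom f) simp
      obtain p' s where p': "coeffs_below v p'" "coeffs_below v s" "monom 1 i * f = p' + s * \<gamma>"
        "\<And>i. D \<le> i \<Longrightarrow> coeff p' i = 0"
        using coeffs_below_reduce[OF \<gamma>(1-3) m] by blast
      have "p' = monom 1 i * f - s * \<gamma>" using p'(3) by simp
      then have "poly p' (tvar v) = tvar v ^ i * poly f (tvar v) - poly s (tvar v) * poly \<gamma> (tvar v)"
        by (simp add: poly_monom)
      also have "\<dots> \<in> I"
        using f(2) \<gamma>(4) p'(2)
        by (intro graded_ideal_diff[OF I] graded_ideal_mult[OF I])
           (auto intro!: polys_below_power tvar_in_polys_below poly_tvar_in_polys_below)
      finally have p'I: "poly p' (tvar v) \<in> I" .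
      have eq: "monom 1 i = eval_coeffs a p' + eval_coeffs a s * eval_coeffs a \<gamma>"
        using arg_cong[OF p'(3), of "eval_coeffs a"] f(3) by simp
      \<comment> \<open>For \<open>i < D\<close>, \<open>monom 1 i\<close> is its own remainder
        modulo the specialised \<open>\<gamma>\<close>, which still has degree \<open>D\<close>. So
        the quotient must specialise to 0.\<close>
      have "eval_coeffs a s = 0"
      proof (rule ccontr)
        assume s0: "eval_coeffs a s \<noteq> 0"
        define e where "e = degree (eval_coeffs a s) + D"
        have "coeff (eval_coeffs a s * eval_coeffs a \<gamma>) e = lead_coeff (eval_coeffs a s)"
          using coeff_mult_degree_sum[of "eval_coeffs a s" "eval_coeffs a \<gamma>"] ev\<gamma>(1)
          by (simp add: deg\<gamma> e_def)
        moreover have "coeff (eval_coeffs a s * eval_coeffs a \<gamma>) e = 0"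
          using arg_cong[OF eq, of "\<lambda>p. coeff p e"] that p'(4)[of e]
          by (simp add: e_def coeff_map_poly)
        ultimately show False using s0 by simp
      qed
      then show ?thesis using p' p'I eq by auto
    qed
    \<comment> \<open>For \<open>D = 0\<close> there are no powers below \<open>D\<close> to start
      the elimination from, but then \<open>\<gamma>\<close> itself is 1.\<close>
    moreover have "\<exists>c\<in>I \<inter> polys_below v. eval_pol a c = 1" if "D = 0"
    proof -
      have "degree \<gamma> = 0" using \<gamma>(3) that degree_le[of 0 \<gamma>] by simp
      then have "poly \<gamma> (tvar v) = 1" using \<gamma>(2) that by (simp add: poly_altdef)
      then show ?thesis using \<gamma>(4) by (intro bexI[of _ 1]) auto
    qed
    ultimately have "\<exists>c\<in>I \<inter> polys_below v. eval_pol a c = 1"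
      using elimination_descent[OF I, of "D - 1" a]
      by (cases D) (auto simp: Suc_le_eq less_Suc_eq_le)
    then show False using a by auto
  qed
  moreover have "p + q \<in> J" if pq: "p \<in> J" "q \<in> J" for p q
  proof -
    obtain p' q' where "coeffs_below v p'" "poly p' (tvar v) \<in> I" "p = eval_coeffs a p'"
      "coeffs_below v q'" "poly q' (tvar v) \<in> I" "q = eval_coeffs a q'"
      using pq by (auto simp: J_def)
    then show ?thesis unfolding J_def
      by (intro image_eqI[of _ _ "p' + q'"]) (auto intro: coeffs_below_add graded_ideal_add[OF I])
  qed
  moreover have "p * q \<in> J" if q: "q \<in> J" for p q
  proof -
    obtain q' where q': "coeffs_below v q'" "poly q' (tvar v) \<in> I" "q = eval_coeffs a q'"
      using q by (auto simp: J_def)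
    define p' :: "'k mpol poly" where "p' = map_poly const_pol p"
    have zero: "const_pol 0 = (0 :: 'k mpol)" by (simp add: const_pol_def)
    have "p = eval_coeffs a p'"
      by (rule poly_eqI) (simp add: p'_def coeff_map_poly zero)
    moreover have "coeffs_below v p'" by (simp add: coeffs_below_def p'_def coeff_map_poly zero)
    ultimately show ?thesis unfolding J_def using q'
      by (intro image_eqI[of _ _ "p' * q'"])
         (auto intro!: coeffs_below_mult graded_ideal_mult[OF I] poly_tvar_in_polys_below)
  qed
  moreover have "eval_coeffs a \<gamma> \<in> J" using \<gamma> by (auto simp: J_def)
  ultimately obtain b where b: "\<And>p. p \<in> J \<Longrightarrow> poly p b = 0"
    using poly_ideal_common_root[of J "eval_coeffs a \<gamma>"] ev\<gamma>0 by blast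
  have "eval_pol (a(v := b)) p = 0" if p: "p \<in> I" for p
  proof -
    \<comment> \<open>Any bound on the exponents of t_v serves here; the sum over all monomials is
      one.\<close>
    have "lookup \<mu> v < Suc (\<Sum>\<mu>\<in>keys p. lookup \<mu> v)" if "\<mu> \<in> keys p" for \<mu>
      using member_le_sum[of \<mu> "keys p" "\<lambda>\<mu>. lookup \<mu> v"] that by simp
    from polys_below_Suc_as_poly[OF graded_ideal_subset[OF I p] this]
    obtain q where q: "coeffs_below v q" "poly q (tvar v) = p" by blast
    then have "eval_coeffs a q \<in> J" using p by (auto simp: J_def)
    then show ?thesis using b eval_poly_tvar[OF q(1), of a b] q(2) by simp
  qed
  then show ?thesis by blast
qed

lemma graded_ideal_restrict:
  fixes I :: "'a::comm_ring_1 mpol set"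
  assumes I: "graded_ideal (Suc v) I"
  shows "graded_ideal v (I \<inter> polys_below v)"
  unfolding graded_ideal_def
proof (intro conjI ballI allI)
  fix p q :: "'a mpol" assume "p \<in> polys_below v" "q \<in> I \<inter> polys_below v"
  then show "p * q \<in> I \<inter> polys_below v"
    by (auto intro!: graded_ideal_mult[OF I] polys_below_mult intro: polys_below_mono[of v "Suc v"])
next
  fix p and q :: nat assume "p \<in> I \<inter> polys_below v"
  then show "hcomp v q p \<in> I \<inter> polys_below v"
    using graded_ideal_hcomp[OF I, of p q] by (auto simp: hcomp_Suc polys_below_def keys_hcomp)
qed (auto intro: graded_ideal_zero[OF I] graded_ideal_add[OF I] polys_below_add)

text \<open>For graded ideals, this spares the usual generic change of coordinates.\<close>

lemma graded_ideal_monic: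
  fixes I :: "'k::field mpol set"
  assumes I: "graded_ideal (Suc v) I"
    and p: "p \<in> I" "eval_pol (\<lambda>i. if i = v then 1 else 0) p \<noteq> 0"
  obtains D r where "tvar v ^ D + r \<in> I" "r \<in> polys_below (Suc v)"
    "\<And>\<mu>. \<mu> \<in> keys r \<Longrightarrow> lookup \<mu> v < D" "\<And>\<mu>. \<mu> \<in> keys r \<Longrightarrow> \<exists>i<v. lookup \<mu> i \<noteq> 0"
proof -
  \<comment> \<open>At the point with last coordinate 1 and all others 0, a homogeneous polynomial
    of degree \<open>D\<close> takes as its value the coefficient of t_v to the power
    \<open>D\<close>. So some component of \<open>p\<close> contains this pure power.\<close>
  define e :: "nat \<Rightarrow> 'k" where "e = (\<lambda>i. if i = v then 1 else 0)"
  have "\<exists>D. eval_pol e (hcomp (Suc v) D p) \<noteq> 0"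
  proof (rule ccontr)
    assume "\<nexists>D. eval_pol e (hcomp (Suc v) D p) \<noteq> 0"
    then have "eval_pol e p = 0"
      by (subst sum_hcomp[OF graded_ideal_subset[OF I p(1)]]) (simp add: eval_pol_sum)
    then show False using p(2) by (simp add: e_def)
  qed
  then obtain D where D: "eval_pol e (hcomp (Suc v) D p) \<noteq> 0" by blast
  define g where "g = hcomp (Suc v) D p"
  have gI: "g \<in> I" unfolding g_def by (rule graded_ideal_hcomp[OF I p(1)])
  have hom: "homogeneous v D g" by (simp add: g_def)
  \<comment> \<open>A monomial of degree \<open>D\<close> other than the pure power involves an
    earlier variable and thus has a smaller exponent at t_v. After scaling, one relation is
    therefore both monic in t_v and nilpotent-ready: its remaining terms lie in the ideal of the
    earlier variables.\<close>
  have key: "lookup \<mu> v < D \<and> (\<exists>i<v. lookup \<mu> i \<noteq> 0)" if "\<mu> \<in> keys g" "\<mu> \<noteq> single v D" for \<mu>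
  proof -
    have \<mu>: "keys \<mu> \<subseteq> {..v}" "(\<Sum>i<v. lookup \<mu> i) + lookup \<mu> v = D"
      using hom that(1) by (auto simp: homogeneous_def simp flip: lessThan_Suc_atMost)
    have "\<exists>i<v. lookup \<mu> i \<noteq> 0"
    proof (rule ccontr)
      assume *: "\<not> (\<exists>i<v. lookup \<mu> i \<noteq> 0)"
      then have "lookup \<mu> i = lookup (single v D) i" for i
        using \<mu> by (cases "i < v"; cases "i = v") (auto simp: lookup_single subset_iff in_keys_iff)
      then show False using that(2) by (simp add: poly_mapping_eqI)
    qed
    then obtain i where i: "i < v" "lookup \<mu> i \<noteq> 0" by blast
    then have "lookup \<mu> i \<le> (\<Sum>i<v. lookup \<mu> i)" by (intro member_le_sum) auto
    then have "lookup \<mu> v < D" using \<mu>(2) i(2) by linarith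
    then show ?thesis using i by blast
  qed
  define c where "c = lookup g (single v D)"
  have "eval_monom e \<mu> = (if \<mu> = single v D then 1 else 0)" if \<mu>: "\<mu> \<in> keys g" for \<mu>
  proof (cases "\<mu> = single v D")
    case True
    then show ?thesis by (simp add: eval_monom_def e_def)
  next
    case False
    then obtain i where "i < v" "lookup \<mu> i \<noteq> 0" using key[OF \<mu>] by blast
    then have "(\<Prod>i\<in>keys \<mu>. e i ^ lookup \<mu> i) = 0"
      by (intro prod_zero) (auto simp: e_def in_keys_iff intro!: bexI[of _ i])
    then show ?thesis using False by (simp add: eval_monom_def)
  qed
  then have "eval_pol e g = (\<Sum>\<mu>\<in>keys g. if \<mu> = single v D then c else 0)"
    unfolding eval_pol_def eval_monom_def[symmetric] by (intro sum.cong) (auto simp: c_def)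
  then have c: "c \<noteq> 0" using D by (auto simp: g_def[symmetric] split: if_splits)
  define g' where "g' = const_pol (1 / c) * g"
  have g'I: "g' \<in> I" unfolding g'_def by (rule graded_ideal_mult[OF I _ gI]) simp
  define r where "r = g' - tvar v ^ D"
  have "lookup g' \<mu> = 1 / c * lookup g \<mu>" for \<mu>
    using lookup_single_mult[of 0 "1 / c" g \<mu>] by (simp add: g'_def const_pol_def)
  then have "lookup r \<mu> = (if \<mu> = single v D then 0 else 1 / c * lookup g \<mu>)" for \<mu>
    using c by (auto simp: r_def lookup_minus tvar_power lookup_single c_def)
  then have keys_r: "\<mu> \<in> keys g" "\<mu> \<noteq> single v D" if "\<mu> \<in> keys r" for \<mu>
    using that by (auto simp: in_keys_iff split: if_splits)
  have "r \<in> polys_below (Suc v)"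
    unfolding r_def using graded_ideal_subset[OF I g'I]
    by (intro polys_below_diff polys_below_power tvar_in_polys_below) auto
  moreover have "tvar v ^ D + r \<in> I" using g'I by (simp add: r_def)
  ultimately show ?thesis using that key keys_r by blast
qed

text \<open>Some element of \<open>I\<close> does not vanish at (0, ..., 0, 1), which yields a monic
  relation for t_v. Through it every zero of the elimination ideal extends to a zero of
  \<open>I\<close>, so the elimination ideal also has no zero besides the origin and the induction
  hypothesis applies to it.\<close>

theorem projective_nullstellensatz:
  fixes I :: "'k::alg_closed_field mpol set"
  assumes "graded_ideal v I"
    and "\<And>a i. (\<And>p. p \<in> I \<Longrightarrow> eval_pol a p = 0) \<Longrightarrow> i < v \<Longrightarrow> a i = 0"
  shows "\<forall>i<v. \<exists>N. tvar i ^ N \<in> I"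
  using assms
proof (induction v arbitrary: I)
  case (Suc v)
  note I = Suc.prems(1)
  obtain p where "p \<in> I" "eval_pol (\<lambda>i. if i = v then 1 else 0) p \<noteq> 0"
    using Suc.prems(2)[of "\<lambda>i. if i = v then 1 else 0" v] by auto
  from graded_ideal_monic[OF I this] obtain D r where r: "tvar v ^ D + r \<in> I"
    "r \<in> polys_below (Suc v)" "\<And>\<mu>. \<mu> \<in> keys r \<Longrightarrow> lookup \<mu> v < D"
    "\<And>\<mu>. \<mu> \<in> keys r \<Longrightarrow> \<exists>i<v. lookup \<mu> i \<noteq> 0" by blast
  obtain q where q: "coeffs_below v q" "\<And>i. D \<le> i \<Longrightarrow> coeff q i = 0" "poly q (tvar v) = r"
    using polys_below_Suc_as_poly[OF r(2,3)] by blast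
  define \<gamma> where "\<gamma> = monom 1 D + q"
  have \<gamma>: "coeffs_below v \<gamma>" "coeff \<gamma> D = 1" "\<And>i. D < i \<Longrightarrow> coeff \<gamma> i = 0" "poly \<gamma> (tvar v) \<in> I"
    using q r(1) by (auto simp: \<gamma>_def poly_monom intro!: coeffs_below_add coeffs_below_monom)
  have below: "\<forall>i<v. \<exists>N. tvar i ^ N \<in> I \<inter> polys_below v"
  proof (rule Suc.IH[OF graded_ideal_restrict[OF I]])
    fix a :: "nat \<Rightarrow> 'k" and i
    assume a: "\<And>p. p \<in> I \<inter> polys_below v \<Longrightarrow> eval_pol a p = 0" and i: "i < v"
    obtain b where "\<And>p. p \<in> I \<Longrightarrow> eval_pol (a(v := b)) p = 0"
      using extend_zero[OF I \<gamma>, of a] a by blast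
    from Suc.prems(2)[OF this, of i] show "a i = 0" using i by simp
  qed
  \<comment> \<open>Modulo \<open>I\<close>, \<open>tvar v ^ D\<close> equals \<open>- r\<close>.
    All terms of \<open>r\<close> involve earlier variables, which are already nilpotent modulo
    \<open>I\<close>, so t_v is nilpotent too.\<close>
  have "\<exists>N. (- r) ^ N \<in> I"
  proof (rule graded_ideal_radical_monomials[OF I, of v])
    show "\<exists>N. tvar i ^ N \<in> I" if "i < v" for i using below that by blast
    show "- r \<in> polys_below (Suc v)" by (rule polys_below_uminus[OF r(2)])
    show "\<exists>i<v. lookup \<mu> i \<noteq> 0" if "\<mu> \<in> keys (- r)" for \<mu>
      using r(4)[of \<mu>] that by (simp add: in_keys_iff)
  qed
  then obtain N where "(- r) ^ N \<in> I" ..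
  moreover have "(tvar v ^ D + r) ^ 1 \<in> I" using r(1) by simp
  ultimately have "((tvar v ^ D + r) + (- r)) ^ (1 + N) \<in> I"
    using graded_ideal_subset[OF I r(1)] r(2)
    by (intro graded_ideal_radical_add[OF I] polys_below_uminus)
  moreover have "((tvar v ^ D + r) + (- r)) ^ (1 + N) = tvar v ^ (D * (1 + N))"
    by (simp add: power_add power_mult)
  ultimately have "tvar v ^ (D * (1 + N)) \<in> I" by metis
  then show ?case using below by (auto simp: less_Suc_eq)
qed simp

section \<open>Lifting vector fields to affine space\<close>

lemma pdiff_superset:
  "finite S \<Longrightarrow> keys p \<subseteq> S \<Longrightarrow>
    pdiff i p = (\<Sum>\<mu>\<in>S. single (\<mu> - single i 1) (of_nat (lookup \<mu> i) * lookup p \<mu>))"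
  unfolding pdiff_def by (rule sum.mono_neutral_left) (auto simp: in_keys_iff)

lemma pdiff_zero [simp]: "pdiff i 0 = 0"
  by (simp add: pdiff_def)

lemma pdiff_add: "pdiff i (p + q) = pdiff i p + pdiff i q"
proof -
  have S: "finite (keys p \<union> keys q)" by simp
  show ?thesis
    using keys_add[of p q]
    by (simp add: pdiff_superset[OF S] lookup_add distrib_left single_add sum.distrib)
qed

lemma pdiff_single: "pdiff i (single \<mu> c) = single (\<mu> - single i 1) (of_nat (lookup \<mu> i) * c)"
  by (simp add: pdiff_def)

text \<open>The product rule for a factor that is a variable; monomials are later built up one
  variable at a time.\<close>

lemma pdiff_tvar_mult: "pdiff i (tvar j * p) = (if i = j then p else 0) + tvar j * pdiff i p"
proof (induction p rule: poly_mapping_add_single_induct)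
  case (add \<mu> c p)
  have "pdiff i (tvar j * single \<mu> c) = (if i = j then single \<mu> c else 0) + tvar j * pdiff i (single \<mu> c)"
  proof (cases "i = j")
    case False
    have "single j (Suc 0) + \<mu> - single i (Suc 0) = single j (Suc 0) + (\<mu> - single i (Suc 0))"
      using False by (intro poly_mapping_eqI) (simp add: lookup_add lookup_minus lookup_single when_def)
    then show ?thesis using False
      by (simp add: tvar_def mult_single pdiff_single lookup_add lookup_single)
  next
    case True
    show ?thesis
    proof (cases "lookup \<mu> j = 0")
      case False
      then have "single j (Suc 0) + (\<mu> - single j (Suc 0)) = \<mu>"
        by (intro single_lookup_minus_add) simp
      then show ?thesis using True
        by (simp add: tvar_def mult_single pdiff_single lookup_add distrib_right single_add)
    qed (use True in \<open>simp add: tvar_def mult_single pdiff_single lookup_add\<close>)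
  qed
  then show ?case using add.IH
    by (cases "i = j") (simp_all add: distrib_left pdiff_add add_ac)
qed simp

text \<open>On a single monomial, \<open>tvar i * pdiff i\<close> is multiplication by the exponent
  of t_i, and these exponents sum to \<open>q\<close>.\<close>

lemma euler_identity:
  fixes p :: "'k::comm_semiring_1 mpol"
  assumes p: "homogeneous n q p"
  shows "(\<Sum>i\<le>n. tvar i * pdiff i p) = of_nat q * p"
proof (induction p rule: poly_mapping_add_single_induct)
  case (add \<mu> c p')
  have "tvar i * pdiff i (single \<mu> c) = single \<mu> (of_nat (lookup \<mu> i) * c)" for i
  proof (cases "lookup \<mu> i = 0")
    case False
    then have "single i (Suc 0) + (\<mu> - single i (Suc 0)) = \<mu>" by (intro single_lookup_minus_add) simp
    then show ?thesis by (simp add: tvar_def mult_single pdiff_single)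
  qed (simp add: pdiff_single)
  moreover have "(\<Sum>i\<in>A. single \<mu> (of_nat (lookup \<mu> i) * c)) = of_nat (\<Sum>i\<in>A. lookup \<mu> i) * single \<mu> c" for A
    by (induction A rule: infinite_finite_induct)
       (simp_all add: distrib_right single_add mult_single flip: single_of_nat)
  moreover have "(\<Sum>i\<le>n. lookup \<mu> i) = q" using p add.hyps by (simp add: homogeneous_def)
  ultimately have "(\<Sum>i\<le>n. tvar i * pdiff i (single \<mu> c)) = of_nat q * single \<mu> c"
    by (simp del: of_nat_sum)
  then show ?case by (simp add: pdiff_add distrib_left sum.distrib add.IH)
qed simp

lemma homogeneous_pdiff:
  fixes p :: "'k::comm_semiring_1 mpol"
  assumes "homogeneous n (Suc q) p" "i \<le> n"
  shows "homogeneous n q (pdiff i p)"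
  unfolding pdiff_def
proof (rule homogeneous_sum)
  fix \<mu> assume \<mu>: "\<mu> \<in> keys p"
  show "homogeneous n q (single (\<mu> - single i 1) (of_nat (lookup \<mu> i) * lookup p \<mu>))"
  proof (cases "lookup \<mu> i = 0")
    case False
    define \<nu> where "\<nu> = \<mu> - single i 1"
    have \<mu>\<nu>: "\<mu> = single i 1 + \<nu>"
      unfolding \<nu>_def using False by (intro single_lookup_minus_add[symmetric]) simp
    have "keys \<mu> \<subseteq> {..n}" "(\<Sum>i\<le>n. lookup \<mu> i) = Suc q"
      using assms(1) \<mu> by (auto simp: homogeneous_def)
    moreover have "(\<Sum>l\<le>n. lookup (single i 1 :: nat \<Rightarrow>\<^sub>0 nat) l) = 1"
      using assms(2) by (simp add: lookup_single when_def)
    ultimately have "keys \<nu> \<subseteq> {..n} \<and> (\<Sum>i\<le>n. lookup \<nu> i) = q"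
      unfolding \<mu>\<nu> by (auto simp: lookup_add sum.distrib in_keys_iff subset_iff)
    then show ?thesis by (auto simp: homogeneous_def \<nu>_def)
  qed simp
qed

lemma apply_field_add: "apply_field n G (p + q) = apply_field n G p + apply_field n G q"
  by (simp add: apply_field_def pdiff_add distrib_left sum.distrib)

lemma apply_field_tvar_mult:
  "j \<le> n \<Longrightarrow> apply_field n G (tvar j * p) = G j * p + tvar j * apply_field n G p"
proof -
  assume j: "j \<le> n"
  have "apply_field n G (tvar j * p) = (\<Sum>i\<le>n. (if i = j then G i * p else 0) + tvar j * (G i * pdiff i p))"
    unfolding apply_field_def by (intro sum.cong) (simp_all add: pdiff_tvar_mult distrib_left mult.left_commute)
  then show ?thesis using j by (simp add: sum.distrib apply_field_def sum_distrib_left)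
qed

lemma apply_field_const [simp]: "apply_field n G (const_pol c) = 0"
  by (simp add: apply_field_def const_pol_def pdiff_single)

lemma apply_field_zero [simp]: "apply_field n G 0 = 0"
  by (simp add: apply_field_def)

lemma homogeneous_apply_field:
  fixes p :: "'k::comm_semiring_1 mpol"
  assumes "homogeneous n (Suc q) p" "\<And>i. i \<le> n \<Longrightarrow> homogeneous n m (G i)"
  shows "homogeneous n (m + q) (apply_field n G p)"
  unfolding apply_field_def using assms
  by (intro homogeneous_sum homogeneous_mult homogeneous_pdiff) auto

section \<open>Derivations on fractions of degree 0\<close>

lemma Fract_eq_divide: "Fraction_Field.Fract a b = to_fract a / to_fract b"
  by (simp add: to_fract_def)

lemma to_fract_power: "to_fract (a ^ N) = to_fract a ^ N"
  by (induction N) simp_all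

lemma to_fract_of_nat: "to_fract (of_nat N) = of_nat N"
  by (induction N) simp_all

lemma twist_sectionsI:
  assumes "homogeneous n q a" "int q = e + int (r * s)" "u = to_fract a / to_fract g ^ r"
  shows "u \<in> twist_sections n e s g"
  using assms unfolding twist_sections_def Fract_eq_divide to_fract_power by blast

context
  fixes n m :: nat and X :: "'k::idom mpol fract \<Rightarrow> 'k mpol fract"
  assumes X: "vector_field n m X"
begin

lemma vector_field_closed:
  assumes "0 < s" "homogeneous n s g" "g \<noteq> 0" "u \<in> twist_sections n 0 s g"
  obtains a q r where "homogeneous n q a" "int q = int m - 1 + int (r * s)"
    "X u = to_fract a / to_fract g ^ r"
proof -
  have "X u \<in> twist_sections n (int m - 1) s g"
    using X assms unfolding vector_field_def by blast
  then show ?thesis using that unfolding twist_sections_def Fract_eq_divide to_fract_power by blast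
qed

lemma vector_field_add:
  "0 < s \<Longrightarrow> homogeneous n s g \<Longrightarrow> g \<noteq> 0 \<Longrightarrow> u \<in> twist_sections n 0 s g \<Longrightarrow>
    v \<in> twist_sections n 0 s g \<Longrightarrow> X (u + v) = X u + X v"
  and vector_field_mult:
  "0 < s \<Longrightarrow> homogeneous n s g \<Longrightarrow> g \<noteq> 0 \<Longrightarrow> u \<in> twist_sections n 0 s g \<Longrightarrow>
    v \<in> twist_sections n 0 s g \<Longrightarrow> X (u * v) = u * X v + v * X u"
  using X unfolding vector_field_def by blast+

lemma vector_field_const: "X (to_fract (const_pol c)) = 0"
  using X unfolding vector_field_def to_fract_def by blast

lemma vector_field_one: "X 1 = 0"
  using vector_field_const[of 1] by (simp add: const_pol_def)

text \<open>The product rule for t_l/t_i = (t_l/t_j)(t_j/t_i). It holds for \<open>X\<close> only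
  inside the ring of a single open set, and both factors are regular where
  \<open>tvar i * tvar j\<close> does not vanish.\<close>

lemma vector_field_chain:
  assumes "i \<le> n" "j \<le> n" "l \<le> n"
  defines "t \<equiv> \<lambda>i. to_fract (tvar i)"
  shows "X (t l / t i) = t l / t j * X (t j / t i) + t j / t i * X (t l / t j)"
proof -
  define g where "g = (tvar i * tvar j :: 'k mpol)"
  have t: "t i \<noteq> 0" for i by (simp add: t_def)
  have g: "homogeneous n 2 g" "g \<noteq> 0"
    using homogeneous_mult[OF homogeneous_tvar homogeneous_tvar, OF assms(1,2)]
    by (simp_all add: g_def numeral_2_eq_2)
  have 1: "t l / t j \<in> twist_sections n 0 2 g"
  proof (rule twist_sectionsI)
    show "homogeneous n 2 (tvar l * tvar i :: 'k mpol)"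
      using homogeneous_mult[OF homogeneous_tvar homogeneous_tvar, OF assms(3,1)] by (simp add: numeral_2_eq_2)
    show "t l / t j = to_fract (tvar l * tvar i) / to_fract g ^ 1"
      using t unfolding g_def t_def by (simp add: field_simps)
  qed simp
  have 2: "t j / t i \<in> twist_sections n 0 2 g"
  proof (rule twist_sectionsI)
    show "homogeneous n 2 (tvar j * tvar j :: 'k mpol)"
      using homogeneous_mult[OF homogeneous_tvar homogeneous_tvar, OF assms(2,2)] by (simp add: numeral_2_eq_2)
    show "t j / t i = to_fract (tvar j * tvar j) / to_fract g ^ 1"
      using t unfolding g_def t_def by (simp add: field_simps)
  qed simp
  have eq: "t l / t i = t l / t j * (t j / t i)" using t by simp
  show ?thesis unfolding eq by (rule vector_field_mult[OF _ g 1 2]) simp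
qed

text \<open>On the chart of t_0 a derivation is determined by its values at the t_j/t_0. The
  right-hand side is the quotient rule with a factor t_0^(q-1) cancelled, a form that also covers
  \<open>q = 0\<close>. The induction splits one variable off the monomial.\<close>

lemma vector_field_on_monomial:
  assumes G: "\<And>j. j \<le> n \<Longrightarrow> X (to_fract (tvar j) / to_fract (tvar 0)) =
      to_fract (tvar 0 * G j - tvar j * G 0) / to_fract (tvar 0) ^ 2"
    and "keys \<mu> \<subseteq> {..n}" "(\<Sum>i\<le>n. lookup \<mu> i) = q"
  shows "X (to_fract (single \<mu> c) / to_fract (tvar 0) ^ q) =
    to_fract (tvar 0 * apply_field n G (single \<mu> c) - of_nat q * single \<mu> c * G 0) /
      to_fract (tvar 0) ^ Suc q"
  using assms(2,3)
proof (induction q arbitrary: \<mu>)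
  case 0
  then have "\<mu> = 0" by (intro poly_mapping_eqI) (auto simp: in_keys_iff subset_iff)
  then have "single \<mu> c = const_pol c" by (simp add: const_pol_def)
  then show ?case by (simp add: vector_field_const)
next
  case (Suc q)
  then obtain j where j: "j \<le> n" "lookup \<mu> j \<noteq> 0"
    by (metis atMost_iff old.nat.distinct(2) sum.neutral)
  define \<nu> where "\<nu> = \<mu> - single j 1"
  have \<mu>\<nu>: "\<mu> = single j 1 + \<nu>"
    unfolding \<nu>_def using j by (intro single_lookup_minus_add[symmetric]) simp
  have "(\<Sum>l\<le>n. lookup (single j 1 :: nat \<Rightarrow>\<^sub>0 nat) l) = 1"
    using j by (simp add: lookup_single when_def)
  then have \<nu>: "keys \<nu> \<subseteq> {..n}" "(\<Sum>i\<le>n. lookup \<nu> i) = q"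
    using Suc.prems unfolding \<mu>\<nu> by (auto simp: lookup_add sum.distrib in_keys_iff subset_iff)
  define b where "b = single \<nu> c"
  define t where "t = to_fract (tvar 0 :: 'k mpol)"
  have t0: "t \<noteq> 0" by (simp add: t_def)
  have eq: "single \<mu> c = tvar j * b" by (simp add: \<mu>\<nu> b_def tvar_def mult_single)
  have hb: "homogeneous n q b" using \<nu> by (auto simp: b_def homogeneous_def)
  have h0: "homogeneous n 1 (tvar 0 :: 'k mpol)" by (rule homogeneous_tvar) simp
  have 1: "to_fract (tvar j) / t \<in> twist_sections n 0 1 (tvar 0)"
    by (rule twist_sectionsI[OF homogeneous_tvar[OF j(1)], of _ 1]) (simp_all add: t_def)
  have 2: "to_fract b / t ^ q \<in> twist_sections n 0 1 (tvar 0)"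
    by (rule twist_sectionsI[OF hb, of _ q]) (simp_all add: t_def)
  have "X (to_fract (single \<mu> c) / t ^ Suc q) = X (to_fract (tvar j) / t * (to_fract b / t ^ q))"
    by (simp add: eq)
  also have "\<dots> = to_fract (tvar j) / t * X (to_fract b / t ^ q) + to_fract b / t ^ q * X (to_fract (tvar j) / t)"
    by (rule vector_field_mult[OF _ h0 _ 1 2]) simp_all
  also have "X (to_fract b / t ^ q) =
      (t * to_fract (apply_field n G b) - of_nat q * to_fract b * to_fract (G 0)) / t ^ Suc q"
    using Suc.IH[OF \<nu>] by (simp add: b_def t_def to_fract_of_nat)
  also have "X (to_fract (tvar j) / t) =
      (t * to_fract (G j) - to_fract (tvar j) * to_fract (G 0)) / t ^ 2"
    using G[OF j(1)] by (simp add: t_def)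
  also have "to_fract (tvar j) / t *
        ((t * to_fract (apply_field n G b) - of_nat q * to_fract b * to_fract (G 0)) / t ^ Suc q) +
      to_fract b / t ^ q * ((t * to_fract (G j) - to_fract (tvar j) * to_fract (G 0)) / t ^ 2) =
      (t * (to_fract (G j) * to_fract b + to_fract (tvar j) * to_fract (apply_field n G b))
        - of_nat (Suc q) * (to_fract (tvar j) * to_fract b) * to_fract (G 0)) / t ^ Suc (Suc q)"
    using t0 by (simp add: field_simps power2_eq_square)
  also have "\<dots> = to_fract (tvar 0 * apply_field n G (single \<mu> c) - of_nat (Suc q) * single \<mu> c * G 0) /
      t ^ Suc (Suc q)"
    unfolding eq apply_field_tvar_mult[OF j(1)]
    by (simp only: to_fract_diff to_fract_mult to_fract_add to_fract_of_nat t_def)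
  finally show ?case by (simp only: t_def)
qed

lemma vector_field_on_homogeneous:
  assumes G: "\<And>j. j \<le> n \<Longrightarrow> X (to_fract (tvar j) / to_fract (tvar 0)) =
      to_fract (tvar 0 * G j - tvar j * G 0) / to_fract (tvar 0) ^ 2"
    and p: "homogeneous n q p"
  shows "X (to_fract p / to_fract (tvar 0) ^ q) =
    to_fract (tvar 0 * apply_field n G p - of_nat q * p * G 0) / to_fract (tvar 0) ^ Suc q"
proof -
  have "homogeneous n q p \<and> X (to_fract p / to_fract (tvar 0) ^ q) =
    to_fract (tvar 0 * apply_field n G p - of_nat q * p * G 0) / to_fract (tvar 0) ^ Suc q"
  proof (induction p rule: poly_mapping_add_single_induct)
    case zero
    then show ?case using vector_field_const[of 0] by (simp add: const_pol_def)
  next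
    case (add \<mu> c p')
    have \<mu>: "keys \<mu> \<subseteq> {..n}" "(\<Sum>i\<le>n. lookup \<mu> i) = q"
      using p add.hyps by (auto simp: homogeneous_def)
    define b where "b = single \<mu> c"
    define t where "t = to_fract (tvar 0 :: 'k mpol)"
    have hb: "homogeneous n q b" using \<mu> by (auto simp: b_def homogeneous_def)
    have h0: "homogeneous n 1 (tvar 0 :: 'k mpol)" by (rule homogeneous_tvar) simp
    have hp': "homogeneous n q p'" using add.IH by blast
    have 1: "to_fract b / t ^ q \<in> twist_sections n 0 1 (tvar 0)"
      by (rule twist_sectionsI[OF hb, of _ q]) (simp_all add: t_def)
    have 2: "to_fract p' / t ^ q \<in> twist_sections n 0 1 (tvar 0)"
      by (rule twist_sectionsI[OF hp', of _ q]) (simp_all add: t_def)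
    have "X (to_fract (b + p') / t ^ q) = X (to_fract b / t ^ q + to_fract p' / t ^ q)"
      by (simp add: add_divide_distrib)
    also have "\<dots> = X (to_fract b / t ^ q) + X (to_fract p' / t ^ q)"
      by (rule vector_field_add[OF _ h0 _ 1 2]) simp_all
    also have "X (to_fract p' / t ^ q) =
       to_fract (tvar 0 * apply_field n G p' - of_nat q * p' * G 0) / t ^ Suc q"
      using add.IH by (simp add: t_def)
    also have "X (to_fract b / t ^ q) =
       to_fract (tvar 0 * apply_field n G b - of_nat q * b * G 0) / t ^ Suc q"
      using vector_field_on_monomial[OF G \<mu>] by (simp add: t_def b_def)
    finally have "X (to_fract (b + p') / t ^ q) =
       to_fract (tvar 0 * apply_field n G (b + p') - of_nat q * (b + p') * G 0) / t ^ Suc q"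
      by (simp add: apply_field_add algebra_simps flip: add_divide_distrib)
    moreover have "homogeneous n q (b + p')" using hb hp' by (rule homogeneous_add)
    ultimately show ?case by (simp add: b_def t_def)
  qed
  then show ?thesis ..
qed

text \<open>Knowing \<open>X\<close> on the chart of t_0 suffices: the product rule for a/t_0^q =
  (a/b)(b/t_0^q) can be solved for the value at a/b.\<close>

lemma vector_field_induced:
  assumes hG: "\<And>j. j \<le> n \<Longrightarrow> homogeneous n m (G j)"
    and G: "\<And>j. j \<le> n \<Longrightarrow> X (to_fract (tvar j) / to_fract (tvar 0)) =
      to_fract (tvar 0 * G j - tvar j * G 0) / to_fract (tvar 0) ^ 2"
  shows "induces n m G X"
  unfolding induces_def
proof (intro conjI allI impI)
  fix q and a b :: "'k mpol"
  assume ab: "homogeneous n q a \<and> homogeneous n q b \<and> b \<noteq> 0"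
  then have ha: "homogeneous n q a" and hb: "homogeneous n q b" and "b \<noteq> 0" by auto
  define t where "t = to_fract (tvar 0 :: 'k mpol)"
  define A B where "A = to_fract a" and "B = to_fract b"
  define GA GB G0 where "GA = to_fract (apply_field n G a)" and "GB = to_fract (apply_field n G b)"
    and "G0 = to_fract (G 0)"
  have t0: "t \<noteq> 0" and B0: "B \<noteq> 0" using \<open>b \<noteq> 0\<close> by (simp_all add: t_def B_def)
  \<comment> \<open>Both a/b and b/t_0^q are regular where \<open>g\<close> does not vanish. The
    factor \<open>tvar 0\<close> also makes the degree of \<open>g\<close> positive when
    \<open>b\<close> is constant.\<close>
  define g where "g = b * tvar 0"
  have h0: "homogeneous n 1 (tvar 0 :: 'k mpol)" by (rule homogeneous_tvar) simp
  have g: "homogeneous n (q + 1) g" "g \<noteq> 0"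
    unfolding g_def using \<open>b \<noteq> 0\<close> homogeneous_mult[OF hb h0] by simp_all
  have gt: "to_fract g = B * t" by (simp add: g_def B_def t_def)
  have 1: "A / B \<in> twist_sections n 0 (q + 1) g"
  proof (rule twist_sectionsI[OF homogeneous_mult[OF ha h0]])
    show "A / B = to_fract (a * tvar 0) / to_fract g ^ 1"
      using t0 B0 by (simp add: A_def gt flip: t_def)
  qed simp
  have 2: "B / t ^ q \<in> twist_sections n 0 (q + 1) g"
  proof (rule twist_sectionsI[OF homogeneous_power[OF hb, of "q + 1"]])
    show "B / t ^ q = to_fract (b ^ (q + 1)) / to_fract g ^ q"
      using t0 B0 by (simp add: to_fract_power gt power_mult_distrib flip: B_def)
  qed (simp add: mult.commute)
  have 3: "X (A / t ^ q) = (t * GA - of_nat q * A * G0) / t ^ Suc q"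
    using vector_field_on_homogeneous[OF G ha] by (simp add: A_def GA_def G0_def t_def to_fract_of_nat)
  have 4: "X (B / t ^ q) = (t * GB - of_nat q * B * G0) / t ^ Suc q"
    using vector_field_on_homogeneous[OF G hb] by (simp add: B_def GB_def G0_def t_def to_fract_of_nat)
  have eq: "A / t ^ q = A / B * (B / t ^ q)" using B0 by simp
  have "X (A / t ^ q) = A / B * X (B / t ^ q) + B / t ^ q * X (A / B)"
    unfolding eq by (rule vector_field_mult[OF _ g 1 2]) simp
  then have "X (A / B) = (X (A / t ^ q) - A / B * X (B / t ^ q)) * t ^ q / B"
    using t0 B0 by (simp add: field_simps)
  also have "\<dots> = (B * GA - A * GB) / B ^ 2"
    unfolding 3 4 using t0 B0 by (simp add: field_simps power2_eq_square)
  finally show "X (Fraction_Field.Fract a b) =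
      Fraction_Field.Fract (b * apply_field n G a - a * apply_field n G b) (b ^ 2)"
    by (simp add: Fract_eq_divide to_fract_power A_def B_def GA_def GB_def)
qed (rule hG)

lemma vector_field_cocycle:
  obtains W where "\<And>i j. i \<le> n \<Longrightarrow> j \<le> n \<Longrightarrow> homogeneous n (m + 1) (W i j)"
    "\<And>i j. i \<le> n \<Longrightarrow> j \<le> n \<Longrightarrow>
      X (to_fract (tvar j) / to_fract (tvar i)) = to_fract (W i j) / to_fract (tvar i) ^ 2"
proof -
  define t :: "nat \<Rightarrow> 'k mpol fract" where "t i = to_fract (tvar i)" for i
  have t0: "t i \<noteq> 0" for i by (simp add: t_def)
  \<comment> \<open>The degree of \<open>a\<close> is m - 1 + r; the equation avoids a subtraction
    that would be truncated for \<open>m = 0\<close>.\<close>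
  have sec: "\<exists>a q r. homogeneous n q a \<and> q + 1 = m + r \<and> X (t j / t i) = to_fract a / t i ^ r"
    if ij: "i \<le> n" "j \<le> n" for i j
  proof -
    have *: "t j / t i \<in> twist_sections n 0 1 (tvar i)"
      by (rule twist_sectionsI[OF homogeneous_tvar[OF ij(2)], of _ 1]) (simp_all add: t_def)
    obtain a q r where "homogeneous n q a" "int q = int m - 1 + int (r * 1)"
      "X (t j / t i) = to_fract a / to_fract (tvar i) ^ r"
      by (rule vector_field_closed[OF zero_less_one homogeneous_tvar[OF ij(1)] tvar_nonzero *])
    then show ?thesis by (intro exI[of _ a] exI[of _ q] exI[of _ r]) (auto simp: t_def)
  qed
  have "\<exists>W. homogeneous n (m + 1) W \<and> X (t j / t i) = to_fract W / t i ^ 2"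
    if ij: "i \<le> n" "j \<le> n" for i j
  proof (cases "i = j")
    case True
    then show ?thesis using vector_field_one t0 by (intro exI[of _ 0]) simp
  next
    case False
    obtain a q r where a: "homogeneous n q a" "q + 1 = m + r" "X (t j / t i) = to_fract a / t i ^ r"
      using sec[OF ij] by blast
    obtain b q' r' where b: "X (t i / t j) = to_fract b / t j ^ r'"
      using sec[OF ij(2,1)] by blast
    \<comment> \<open>Differentiating 1 = (t_i/t_j)(t_j/t_i) relates the two charts: t_i^2
      X(t_j/t_i) is the negative of t_j^2 X(t_i/t_j), so it has a power of t_i and also a power of
      t_j as denominator.\<close>
    have "X 1 = t i / t j * X (t j / t i) + t j / t i * X (t i / t j)"
      using vector_field_chain[OF ij(1,2,1)] t0[of i] by (simp add: t_def)
    then have "t i ^ 2 * to_fract a * t j ^ r' = - (t j ^ 2 * to_fract b * t i ^ r)"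
      unfolding vector_field_one a b using t0[of i] t0[of j]
      by (simp add: field_simps power2_eq_square eq_neg_iff_add_eq_0)
    then have "to_fract (tvar j ^ r' * (tvar i ^ 2 * a)) = to_fract (tvar i ^ r * (- (tvar j ^ 2 * b)))"
      by (simp add: t_def to_fract_power ac_simps)
    then have "tvar j ^ r' * (tvar i ^ 2 * a) = tvar i ^ r * (- (tvar j ^ 2 * b))"
      by (simp only: to_fract_eq_iff)
    then have "tvar i ^ r dvd tvar j ^ r' * (tvar i ^ 2 * a)" by (metis dvd_triv_left)
    then have "tvar i ^ r dvd tvar i ^ 2 * a" by (rule tvar_power_dvd_tvar_power_mult[OF False])
    then obtain W where W: "tvar i ^ 2 * a = tvar i ^ r * W" ..
    have "homogeneous n (2 + q) (tvar i ^ 2 * a)"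
      by (intro homogeneous_mult homogeneous_tvar_power a ij)
    then have "homogeneous n (r + (m + 1)) (tvar i ^ r * W)" unfolding W using a(2) by (simp add: algebra_simps)
    then have "homogeneous n (m + 1) W" using ij(1) by (rule homogeneous_tvar_power_mult_cancel)
    moreover have "t i ^ 2 * to_fract a = t i ^ r * to_fract W"
      using arg_cong[OF W, of to_fract] by (simp add: t_def to_fract_power)
    then have "X (t j / t i) = to_fract W / t i ^ 2" unfolding a using t0 by (simp add: field_simps)
    ultimately show ?thesis by blast
  qed
  then obtain W where "\<And>i j. i \<le> n \<Longrightarrow> j \<le> n \<Longrightarrow>
     homogeneous n (m + 1) (W i j) \<and> X (t j / t i) = to_fract (W i j) / t i ^ 2" by metis
  then show ?thesis using that unfolding t_def by blast
qed

text \<open>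
  For \<open>n = 0\<close> the field is 0 on \<open>\<bbbP>\<^sup>0\<close>, and its lift must be chosen to be 0: the derivative of \<open>F\<close>
  along an arbitrary lift need not be a multiple of \<open>F\<close>.
\<close>

theorem vector_field_lift:
  obtains G where "induces n m G X" "n = 0 \<Longrightarrow> G 0 = 0"
proof (cases "n = 0")
  case True
  have "induces n m (\<lambda>_. 0) X"
    by (rule vector_field_induced) (use True vector_field_one in auto)
  then show ?thesis using that by simp
next
  case False
  then have n: "1 \<le> n" by simp
  obtain W where hW: "\<And>i j. i \<le> n \<Longrightarrow> j \<le> n \<Longrightarrow> homogeneous n (m + 1) (W i j)"
    and W: "\<And>i j. i \<le> n \<Longrightarrow> j \<le> n \<Longrightarrow>
      X (to_fract (tvar j) / to_fract (tvar i)) = to_fract (W i j) / to_fract (tvar i) ^ 2"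
    using vector_field_cocycle by blast
  have W00: "W 0 0 = 0" using W[of 0 0] vector_field_one by simp
  have cocycle: "tvar j * W i l = tvar l * W i j + tvar i * W j l" if "i \<le> n" "j \<le> n" "l \<le> n" for i j l
  proof -
    have t0: "to_fract (tvar i :: 'k mpol) \<noteq> 0" for i by simp
    have "to_fract (W i l) / to_fract (tvar i) ^ 2 =
        to_fract (tvar l) / to_fract (tvar j) * (to_fract (W i j) / to_fract (tvar i) ^ 2) +
        to_fract (tvar j) / to_fract (tvar i) * (to_fract (W j l) / to_fract (tvar j) ^ 2)"
      using vector_field_chain[OF that] W that by simp
    then have "to_fract (tvar j) * to_fract (W i l) =
        to_fract (tvar l) * to_fract (W i j) + to_fract (tvar i) * to_fract (W j l)"
      using t0[of i] t0[of j] by (simp add: field_simps power2_eq_square del: to_fract_eq_0_iff)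
    then show ?thesis by (simp flip: to_fract_mult to_fract_add)
  qed
  \<comment> \<open>The equation W_01 = t_0 G_1 - t_1 G_0 is solvable only if W_01 lies in the ideal
    of t_0 and t_1. By the cocycle relation t_2 W_01 does, and t_2 can be cancelled modulo this
    ideal; for \<open>n = 1\<close> it is enough that W_01 has positive degree.\<close>
  have "W 0 1 \<in> power_ideal (\<lambda>_. 1) (Suc 1)"
    unfolding power_ideal_def
  proof (intro CollectI ballI, rule ccontr)
    fix \<mu> assume \<mu>: "\<mu> \<in> keys (W 0 1)" and "\<not> (\<exists>i<Suc 1. 1 \<le> lookup \<mu> i)"
    then have z: "lookup \<mu> 0 = 0" "lookup \<mu> 1 = 0" by (auto simp: Suc_le_eq)
    show False
    proof (cases "n = 1")
      case True
      then have "(\<Sum>i\<le>1. lookup \<mu> i) = m + 1" using hW[of 0 1] \<mu> by (simp add: homogeneous_def)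
      then show False using z by simp
    next
      case False
      then have n2: "2 \<le> n" using n by simp
      define \<nu> where "\<nu> = single 2 1 + \<mu>"
      have "\<nu> \<notin> keys (tvar i * p :: 'k mpol)" if "i < 2" for i p
        using tvar_dvd_iff[of i "tvar i * p"] that z
        by (auto simp: \<nu>_def lookup_add lookup_single less_2_cases_iff)
      then have "lookup (tvar 1 * W 0 2) \<nu> = 0" "lookup (tvar 0 * W 1 2) \<nu> = 0"
        by (auto simp: in_keys_iff)
      moreover have "lookup (tvar 2 * W 0 1) \<nu> \<noteq> 0"
        using \<mu> by (simp add: \<nu>_def tvar_def lookup_single_mult in_keys_iff)
      ultimately show False
        using arg_cong[OF cocycle[of 0 1 2], of "\<lambda>p. lookup p \<nu>"] n2 by (simp add: lookup_add)
    qed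
  qed
  \<comment> \<open>Comparison with W_01 = t_0 G_1 - t_1 G_0 shows the roles: \<open>- v\<close>
    becomes G_0, and \<open>u\<close> becomes t_0 G_1.\<close>
  then obtain u v where u: "u \<in> power_ideal (\<lambda>_. 1) 1" and v: "W 0 1 = u + tvar 1 * v"
    using power_ideal_Suc_split[of "W 0 1" "\<lambda>_. 1" 1] by auto
  have u_dvd: "tvar 0 dvd u" using u by (simp add: tvar_dvd_iff power_ideal_def Suc_le_eq)
  \<comment> \<open>Modulo t_0, the cocycle relation reads t_1 W_0j = t_j W_01 = t_j t_1 v, and t_1
    can be cancelled. So the choice of \<open>v\<close> made for \<open>j = 1\<close> works for
    every \<open>j\<close>.\<close>
  have "\<exists>h. W 0 j - tvar j * v = tvar 0 * h" if "j \<le> n" for j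
  proof -
    have "tvar 1 * (W 0 j - tvar j * v) = tvar 0 * W 1 j + tvar j * u"
      using cocycle[of 0 1 j] n that v by (simp add: algebra_simps)
    also have "tvar 0 dvd \<dots>" using u_dvd by simp
    finally have "tvar 0 ^ 1 dvd tvar 1 ^ 1 * (W 0 j - tvar j * v)" by simp
    then have "tvar 0 dvd W 0 j - tvar j * v"
      using tvar_power_dvd_tvar_power_mult[of 0 1 1 1] by simp
    then show ?thesis by (auto elim: dvdE)
  qed
  then obtain h where h: "\<And>j. j \<le> n \<Longrightarrow> W 0 j - tvar j * v = tvar 0 * h j" by metis
  have "tvar 0 * h 0 = tvar 0 * (- v)" using h[of 0] W00 by simp
  then have h0: "h 0 = - v" by (simp only: mult_cancel_left) simp
  \<comment> \<open>The \<open>h j\<close> come from an arbitrary splitting and need not be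
    homogeneous. As \<open>W 0 j\<close> is homogeneous of degree \<open>m + 1\<close>, their
    components of degree \<open>m\<close> solve the same equations.\<close>
  define G where "G j = hcomp (Suc n) m (h j)" for j
  have GW: "tvar 0 * G j - tvar j * G 0 = W 0 j" if "j \<le> n" for j
  proof -
    have "W 0 j = hcomp (Suc n) (1 + m) (W 0 j)"
      using hW[of 0 j] that by (simp add: homogeneous_iff_hcomp)
    also have "\<dots> = hcomp (Suc n) (1 + m) (tvar 0 * h j - tvar j * h 0)"
      using h[OF that] by (intro arg_cong[of _ _ "hcomp _ _"]) (simp add: h0 algebra_simps)
    also have "\<dots> = tvar 0 * G j - tvar j * G 0"
      unfolding G_def hcomp_diff using that
      by (simp only: hcomp_mult_homogeneous[OF homogeneous_tvar] le0)
    finally show ?thesis by simp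
  qed
  have "induces n m G X"
    by (rule vector_field_induced) (simp_all add: GW W, simp add: G_def)
  then show ?thesis using that False by blast
qed

end

section \<open>Invariant hypersurfaces\<close>

text \<open>Invariance, applied to the section F/t_i^d of the ideal sheaf, shows that
  \<open>F\<close> divides the derivative of \<open>F\<close> up to a power of t_i. Doing this for
  two different variables removes the powers.\<close>

lemma vector_field_derivative_of_invariant:
  fixes F :: "'k::idom mpol"
  assumes G: "induces n m G X" "n = 0 \<Longrightarrow> G 0 = 0"
    and F: "homogeneous n d F" "F \<noteq> 0"
    and inv: "leaves_invariant n m d F X"
  shows "F dvd apply_field n G F"
proof (cases "n = 0")
  case True
  then show ?thesis using G(2) by (simp add: apply_field_def)
next
  case False
  define A where "A = apply_field n G F"
  have "\<exists>M B. tvar i ^ M * A = F * B" if i: "i \<le> n" for i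
  proof -
    define t :: "'k mpol" where "t = tvar i"
    have t0: "t \<noteq> 0" by (simp add: t_def)
    have "Fraction_Field.Fract (1 * F) (t ^ d) \<in> ideal_sections n d F 0 1 t"
      unfolding ideal_sections_def by (intro CollectI exI[of _ 1] exI[of _ 0] exI[of _ d]) simp
    then have "X (Fraction_Field.Fract F (t ^ d)) \<in> ideal_sections n d F (int m - 1) 1 t"
      using inv homogeneous_tvar[OF i] t0 unfolding leaves_invariant_def t_def by (metis mult_1 zero_less_one)
    then obtain a r where "X (Fraction_Field.Fract F (t ^ d)) = Fraction_Field.Fract (a * F) (t ^ r)"
      unfolding ideal_sections_def by blast
    moreover have "X (Fraction_Field.Fract F (t ^ d)) =
        Fraction_Field.Fract (t ^ d * A - F * apply_field n G (t ^ d)) ((t ^ d) ^ 2)"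
      using G(1) F(1) homogeneous_tvar_power[OF i, of d] power_not_zero[OF t0, of d]
      unfolding induces_def A_def t_def by blast
    ultimately have "(t ^ d * A - F * apply_field n G (t ^ d)) * t ^ r = a * F * (t ^ d) ^ 2"
      using t0 by (simp add: eq_fract)
    then have "t ^ (d + r) * A = F * (a * (t ^ d) ^ 2 + apply_field n G (t ^ d) * t ^ r)"
      by (simp add: algebra_simps power_add)
    then show ?thesis unfolding t_def by blast
  qed
  \<comment> \<open>Two distinct variables exist only for \<open>n > 0\<close>; after cancelling
    \<open>F\<close>, coprimality of their powers shows that \<open>tvar 0 ^ M\<close> divides
    \<open>B\<close>.\<close>
  from this[of 0] this[of 1] False obtain M B M' B' where
    B: "tvar 0 ^ M * A = F * B" and B': "tvar 1 ^ M' * A = F * B'" by auto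
  have "F * (tvar 1 ^ M' * B) = tvar 1 ^ M' * (tvar 0 ^ M * A)"
    unfolding B by (rule mult.left_commute)
  also have "\<dots> = tvar 0 ^ M * (F * B')" unfolding B'[symmetric] by (rule mult.left_commute)
  finally have "F * (tvar 1 ^ M' * B) = F * (tvar 0 ^ M * B')" by (simp add: ac_simps)
  then have "tvar 1 ^ M' * B = tvar 0 ^ M * B'" using F(2) by simp
  then have "tvar 0 ^ M dvd tvar 1 ^ M' * B" by simp
  then have "tvar 0 ^ M dvd B" by (rule tvar_power_dvd_tvar_power_mult[rotated]) simp
  then obtain C where "B = tvar 0 ^ M * C" ..
  then have "tvar 0 ^ M * A = tvar 0 ^ M * (F * C)" using B by (simp add: ac_simps)
  then have "A = F * C" by simp
  then show ?thesis by (simp add: A_def)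
qed

text \<open>The cofactor should have degree m - 1. Asking instead for \<open>tvar i * P\<close> to
  have degree \<open>m\<close> also makes sense for \<open>m = 0\<close>, where the derivative of
  \<open>F\<close> has degree below that of \<open>F\<close>, hence is 0, and \<open>P\<close> is
  taken to be 0.\<close>

lemma homogeneous_cofactor:
  fixes F :: "'k::idom mpol"
  assumes G: "\<And>i. i \<le> n \<Longrightarrow> homogeneous n m (G i)"
    and F: "homogeneous n (Suc d) F" and dvd: "F dvd apply_field n G F"
  obtains P where "apply_field n G F = F * P" "\<And>i. i \<le> n \<Longrightarrow> homogeneous n m (tvar i * P)"
proof -
  obtain C where C: "apply_field n G F = F * C" using dvd ..
  have hom: "hcomp (Suc n) (m + d) (F * C) = F * C"
    using homogeneous_apply_field[OF F, of m G, OF G] unfolding C by (simp add: homogeneous_iff_hcomp)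
  show ?thesis
  proof (cases m)
    case 0
    then have "F * C = 0" using hcomp_mult_homogeneous_small[OF F, of d C] hom by simp
    then show ?thesis using that[of 0] C by simp
  next
    case (Suc m')
    then have "F * C = hcomp (Suc n) (Suc d + m') (F * C)" using hom by (simp add: add.commute)
    also have "\<dots> = F * hcomp (Suc n) m' C" by (rule hcomp_mult_homogeneous[OF F])
    finally have "F * C = F * hcomp (Suc n) m' C" .
    moreover have "homogeneous n m (tvar i * hcomp (Suc n) m' C)" if "i \<le> n" for i
      using homogeneous_mult[OF homogeneous_tvar[OF that] homogeneous_hcomp, of m' C] Suc by simp
    ultimately show ?thesis using that C by simp
  qed
qed

lemma apply_field_add_radial:
  fixes a :: "'k::comm_semiring_1 mpol"
  assumes "homogeneous n q a"
  shows "apply_field n (\<lambda>i. G i + H * tvar i) a = apply_field n G a + H * (of_nat q * a)"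
  using euler_identity[OF assms]
  by (simp add: apply_field_def distrib_right sum.distrib mult.assoc flip: sum_distrib_left)

text \<open>By the Euler identity the radial field multiplies numerator and denominator by the same
  integer \<open>q\<close>, so its contributions cancel in the quotient rule.\<close>

lemma induces_add_radial:
  fixes G :: "nat \<Rightarrow> 'k::idom mpol"
  assumes G: "induces n m G X" and H: "\<And>i. i \<le> n \<Longrightarrow> homogeneous n m (H * tvar i)"
  shows "induces n m (\<lambda>i. G i + H * tvar i) X"
  using assms unfolding induces_def
  by (auto simp: apply_field_add_radial algebra_simps intro!: homogeneous_add)

lemma induces_cong:
  assumes "\<And>i. i \<le> n \<Longrightarrow> G i = G' i"
  shows "induces n m G X \<longleftrightarrow> induces n m G' X"
proof -
  have "apply_field n G a = apply_field n G' a" for a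
    unfolding apply_field_def using assms by (intro sum.cong) auto
  then show ?thesis using assms by (simp add: induces_def)
qed

lemma invariant_vector_field_lift:
  fixes F :: "'k::field mpol"
  assumes X: "vector_field n m X"
    and F: "homogeneous n (Suc d) F" "F \<noteq> 0" and d: "(of_nat (Suc d) :: 'k) \<noteq> 0"
    and inv: "leaves_invariant n m (Suc d) F X"
  obtains G where "induces n m G X" "apply_field n G F = 0"
proof -
  obtain G where G: "induces n m G X" "n = 0 \<Longrightarrow> G 0 = 0" using vector_field_lift[OF X] by blast
  have hG: "homogeneous n m (G i)" if "i \<le> n" for i using G(1) that by (simp add: induces_def)
  obtain P where P: "apply_field n G F = F * P" "\<And>i. i \<le> n \<Longrightarrow> homogeneous n m (tvar i * P)"
    using homogeneous_cofactor[OF hG F(1) vector_field_derivative_of_invariant[OF G F inv]] by blast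
  define c where "c = const_pol (- 1 / of_nat (Suc d) :: 'k)"
  have "c * of_nat (Suc d) = - 1"
    using d by (simp add: c_def const_pol_def mult_single single_uminus flip: single_of_nat of_nat_Suc)
  then have "c * P * (of_nat (Suc d) * F) = - (F * P)"
    by (metis (no_types, lifting) mult.assoc mult.commute mult_minus1)
  then have "apply_field n (\<lambda>i. G i + c * P * tvar i) F = 0"
    using apply_field_add_radial[OF F(1), of G "c * P"] P(1) by simp
  moreover have "induces n m (\<lambda>i. G i + c * P * tvar i) X"
  proof (rule induces_add_radial[OF G(1)])
    fix i assume "i \<le> n"
    then have "homogeneous n (0 + m) (c * (tvar i * P))"
      unfolding c_def by (intro homogeneous_mult homogeneous_const P)
    then show "homogeneous n m (c * P * tvar i)" by (simp add: ac_simps)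
  qed
  ultimately show ?thesis using that by blast
qed

section \<open>The ideal of the partial derivatives and their syzygies\<close>

definition generated_ideal :: "nat \<Rightarrow> (nat \<Rightarrow> 'k::comm_ring_1 mpol) \<Rightarrow> 'k mpol set" where
  "generated_ideal n f = {p. \<exists>c. (\<forall>l\<le>n. c l \<in> polys_below (Suc n)) \<and> p = (\<Sum>l\<le>n. c l * f l)}"

lemma generated_idealI:
  "(\<And>l. l \<le> n \<Longrightarrow> c l \<in> polys_below (Suc n)) \<Longrightarrow> p = (\<Sum>l\<le>n. c l * f l) \<Longrightarrow> p \<in> generated_ideal n f"
  by (auto simp: generated_ideal_def)

text \<open>All generators have the same degree \<open>D\<close>, so a component of degree
  \<open>q\<close> of a combination is the combination with the components of degree
  \<open>q - D\<close> of the coefficients, and is 0 for \<open>q < D\<close>.\<close>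

lemma graded_generated_ideal:
  fixes f :: "nat \<Rightarrow> 'k::comm_ring_1 mpol"
  assumes f: "\<And>l. l \<le> n \<Longrightarrow> homogeneous n D (f l)"
  shows "graded_ideal (Suc n) (generated_ideal n f)"
  unfolding graded_ideal_def
proof (intro conjI ballI allI)
  show "generated_ideal n f \<subseteq> polys_below (Suc n)"
    unfolding generated_ideal_def
    by (auto intro!: polys_below_sum polys_below_mult homogeneous_polys_below[OF f])
  show "0 \<in> generated_ideal n f" by (rule generated_idealI[of _ "\<lambda>_. 0"]) simp_all
next
  fix p q assume "p \<in> generated_ideal n f" "q \<in> generated_ideal n f"
  then obtain c c' where "\<forall>l\<le>n. c l \<in> polys_below (Suc n)" "p = (\<Sum>l\<le>n. c l * f l)"
    "\<forall>l\<le>n. c' l \<in> polys_below (Suc n)" "q = (\<Sum>l\<le>n. c' l * f l)"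
    unfolding generated_ideal_def by blast
  then show "p + q \<in> generated_ideal n f"
    by (intro generated_idealI[of _ "\<lambda>l. c l + c' l"])
       (auto simp: distrib_right sum.distrib intro: polys_below_add)
next
  fix p q :: "'k mpol" assume "p \<in> polys_below (Suc n)" "q \<in> generated_ideal n f"
  then obtain c where "\<forall>l\<le>n. c l \<in> polys_below (Suc n)" "q = (\<Sum>l\<le>n. c l * f l)"
    unfolding generated_ideal_def by blast
  then show "p * q \<in> generated_ideal n f" using \<open>p \<in> polys_below (Suc n)\<close>
    by (intro generated_idealI[of _ "\<lambda>l. p * c l"])
       (auto simp: sum_distrib_left mult.assoc intro: polys_below_mult)
next
  fix p and q assume "p \<in> generated_ideal n f"
  \<comment> \<open>The bound on the variables of \<open>c\<close> can be forgotten: components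
    taken with \<open>hcomp\<close> satisfy it again.\<close>
  then obtain c where p: "p = (\<Sum>l\<le>n. f l * c l)"
    unfolding generated_ideal_def by (auto simp: mult.commute)
  show "hcomp (Suc n) q p \<in> generated_ideal n f"
  proof (cases "D \<le> q")
    case True
    have "hcomp (Suc n) q p = (\<Sum>l\<le>n. hcomp (Suc n) (q - D) (c l) * f l)"
      unfolding p hcomp_sum
    proof (intro sum.cong refl)
      fix l assume "l \<in> {..n}"
      then show "hcomp (Suc n) q (f l * c l) = hcomp (Suc n) (q - D) (c l) * f l"
        using hcomp_mult_homogeneous[OF f, of l "q - D" "c l"] True by (simp add: mult.commute)
    qed
    then show ?thesis 
      by (rule generated_idealI[rotated]) (rule homogeneous_polys_below[OF homogeneous_hcomp])
  next
    case False
    have "hcomp (Suc n) q p = (\<Sum>l\<le>n. 0 * f l)"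
      unfolding p hcomp_sum using hcomp_mult_homogeneous_small[OF f] False by (intro sum.cong) auto
    then show ?thesis by (rule generated_idealI[rotated]) simp
  qed
qed

text \<open>As \<open>Suc d\<close> is invertible in the field, the Euler identity makes
  \<open>F\<close> vanish at a common zero of its partial derivatives. If \<open>a i\<close> were
  nonzero, scaling the coordinate to 1 would move the point into the chart where smoothness is
  stated.\<close>

lemma smooth_no_common_zero:
  fixes F :: "'k::field mpol"
  assumes F: "homogeneous n (Suc d) F" and smooth: "smooth_hypersurface n F"
    and d: "(of_nat (Suc d) :: 'k) \<noteq> 0"
    and a: "\<And>l. l \<le> n \<Longrightarrow> eval_pol a (pdiff l F) = 0" and i: "i \<le> n"
  shows "a i = 0"
proof (rule ccontr)
  assume ai: "a i \<noteq> 0"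
  have "of_nat (Suc d) * eval_pol a F = 0"
    using arg_cong[OF euler_identity[OF F], of "eval_pol a"] a
    by (simp add: eval_pol_sum del: of_nat_Suc)
  then have Fa: "eval_pol a F = 0" using d by (simp del: of_nat_Suc)
  define b where "b = (\<lambda>l. inverse (a i) * a l)"
  have "b i = 1" using ai by (simp add: b_def)
  moreover have "eval_pol b F = 0" unfolding b_def eval_pol_homogeneous_scale[OF F] by (simp add: Fa)
  ultimately obtain j where j: "j \<le> n" "eval_pol b (pdiff j F) \<noteq> 0"
    using smooth i unfolding smooth_hypersurface_def by blast
  moreover have "eval_pol b (pdiff j F) = 0"
    unfolding b_def eval_pol_homogeneous_scale[OF homogeneous_pdiff[OF F j(1)]] by (simp add: a j)
  ultimately show False by simp
qed

text \<open>Here \<open>d\<close> is the degree of the partial derivatives, one less than that of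
  \<open>F\<close>. The Koszul coefficients come without a degree; taking components of degree
  \<open>m\<close> in the relation for \<open>G l\<close> gives all of them the common degree
  \<open>m - d\<close>.\<close>

lemma partials_syzygy:
  fixes F :: "'k::alg_closed_field mpol"
  assumes F: "homogeneous n (Suc d) F" and smooth: "smooth_hypersurface n F"
    and d: "(of_nat (Suc d) :: 'k) \<noteq> 0"
    and G: "\<And>i. i \<le> n \<Longrightarrow> homogeneous n m (G i)" "apply_field n G F = 0"
  obtains P e where "\<And>i j. homogeneous n e (P i j)"
    "\<And>l. l \<le> n \<Longrightarrow> G l = (\<Sum>j\<in>{l<..n}. P l j * pdiff j F) - (\<Sum>j<l. P j l * pdiff j F)"
proof -
  define f where "f l = pdiff l F" for l
  have f: "homogeneous n d (f l)" if "l \<le> n" for l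
    unfolding f_def using F that by (rule homogeneous_pdiff)
  have "\<forall>i<Suc n. \<exists>N. tvar i ^ N \<in> generated_ideal n f"
  proof (rule projective_nullstellensatz)
    show "graded_ideal (Suc n) (generated_ideal n f)" using f by (rule graded_generated_ideal)
    fix a :: "nat \<Rightarrow> 'k" and i
    assume a: "\<And>p. p \<in> generated_ideal n f \<Longrightarrow> eval_pol a p = 0" and i: "i < Suc n"
    have "f l \<in> generated_ideal n f" if "l \<le> n" for l
      using that by (intro generated_idealI[of _ "\<lambda>j. if j = l then 1 else 0"])
        (auto simp: if_distrib[of "\<lambda>x. x * _"] cong: if_cong)
    then have "eval_pol a (pdiff l F) = 0" if "l \<le> n" for l using a that by (simp add: f_def)
    then show "a i = 0" using smooth_no_common_zero[OF F smooth d] i by simp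
  qed
  then obtain N where "\<And>i. i \<le> n \<Longrightarrow> tvar i ^ N i \<in> generated_ideal n f"
    by (metis less_Suc_eq_le)
  then have "\<forall>i. \<exists>c. i \<le> n \<longrightarrow> tvar i ^ N i = (\<Sum>l\<le>n. c l * f l)"
    unfolding generated_ideal_def by blast
  then obtain c where c: "\<And>i. i \<le> n \<Longrightarrow> tvar i ^ N i = (\<Sum>l\<le>n. c i l * f l)" by metis
  have "(\<Sum>j\<le>n. G j * f j) = 0" using G(2) by (simp add: apply_field_def f_def)
  from koszul_syzygy[of "power_ideal N" "\<lambda>j. tvar j ^ N j" n c f G,
    OF is_ideal_power_ideal power_ideal_0 power_ideal_Suc_split power_ideal_Suc_add
      power_ideal_regular c this]
  obtain P where P: "\<And>l. l \<le> n \<Longrightarrow> G l = (\<Sum>j\<in>{l<..n}. f j * P l j) - (\<Sum>j<l. f j * P j l)"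
    by (auto simp: mult.commute)
  have hG: "G l = (\<Sum>j\<in>{l<..n}. hcomp (Suc n) m (f j * P l j)) - (\<Sum>j<l. hcomp (Suc n) m (f j * P j l))"
    if "l \<le> n" for l
  proof -
    have "G l = hcomp (Suc n) m (G l)" using G(1)[OF that] by (simp add: homogeneous_iff_hcomp)
    also have "\<dots> = hcomp (Suc n) m ((\<Sum>j\<in>{l<..n}. f j * P l j) - (\<Sum>j<l. f j * P j l))"
      by (rule arg_cong[OF P[OF that]])
    finally show ?thesis by (simp add: hcomp_diff hcomp_sum)
  qed
  show ?thesis
  proof (cases "d \<le> m")
    case True
    have *: "hcomp (Suc n) m (f j * p) = hcomp (Suc n) (m - d) p * pdiff j F" if "j \<le> n" for j p
      using hcomp_mult_homogeneous[OF f[OF that], of "m - d" p] True by (simp add: f_def mult.commute)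
    show ?thesis
    proof (rule that[of "m - d" "\<lambda>i j. hcomp (Suc n) (m - d) (P i j)"])
      fix l assume "l \<le> n"
      then show "G l = (\<Sum>j\<in>{l<..n}. hcomp (Suc n) (m - d) (P l j) * pdiff j F) -
          (\<Sum>j<l. hcomp (Suc n) (m - d) (P j l) * pdiff j F)"
        unfolding hG[OF \<open>l \<le> n\<close>] by (intro arg_cong2[of _ _ _ _ minus] sum.cong) (auto simp: *)
    qed simp
  \<comment> \<open>For \<open>m < d\<close> no multiple of a partial derivative has a component of
    degree \<open>m\<close>, so all \<open>G l\<close> are 0 and zero coefficients of any degree
    will do.\<close>
  next
    case False
    have *: "hcomp (Suc n) m (f j * p) = 0" if "j \<le> n" for j p
      using hcomp_mult_homogeneous_small[OF f[OF that]] False by simp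
    show ?thesis
    proof (rule that[of 0 "\<lambda>_ _. 0"])
      fix l assume "l \<le> n"
      then show "G l = (\<Sum>j\<in>{l<..n}. 0 * pdiff j F) - (\<Sum>j<l. 0 * pdiff j F)"
        unfolding hG[OF \<open>l \<le> n\<close>] by (simp add: *)
    qed simp
  qed
qed

text \<open>The coefficient at the \<open>l\<close>-th coordinate field: only pairs with first entry
  \<open>l\<close> or second entry \<open>l\<close> contribute, which gives the two halves of the
  Koszul boundary.\<close>

lemma sum_upper_triangle_coord_field:
  fixes P :: "nat \<Rightarrow> nat \<Rightarrow> 'k::comm_ring_1 mpol"
  assumes l: "l \<le> n"
  shows "(\<Sum>(i, j)\<in>{(i, j). i < j \<and> j \<le> n}. P i j * (f j * coord_field i l - f i * coord_field j l))
    = (\<Sum>j\<in>{l<..n}. P l j * f j) - (\<Sum>j<l. P j l * f j)"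
proof -
  define T where "T = {(i, j). i < j \<and> j \<le> n}"
  have fin: "finite T" by (rule finite_subset[of _ "{..n} \<times> {..n}"]) (auto simp: T_def)
  have "(\<Sum>(i, j)\<in>T. P i j * (f j * coord_field i l - f i * coord_field j l)) =
      (\<Sum>x\<in>T. if fst x = l then P (fst x) (snd x) * f (snd x) else 0) -
      (\<Sum>x\<in>T. if snd x = l then P (fst x) (snd x) * f (fst x) else 0)"
    unfolding sum_subtractf[symmetric]
    by (intro sum.cong) (auto simp: coord_field_def)
  also have "(\<Sum>x\<in>T. if fst x = l then P (fst x) (snd x) * f (snd x) else 0) =
      (\<Sum>x\<in>{x\<in>T. fst x = l}. P (fst x) (snd x) * f (snd x))"
    using fin by (rule sum.inter_filter[symmetric])
  also have "\<dots> = (\<Sum>j\<in>{l<..n}. P l j * f j)"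
    by (rule sum.reindex_bij_witness[of _ "Pair l" snd]) (auto simp: T_def)
  also have "(\<Sum>x\<in>T. if snd x = l then P (fst x) (snd x) * f (fst x) else 0) =
      (\<Sum>x\<in>{x\<in>T. snd x = l}. P (fst x) (snd x) * f (fst x))"
    using fin by (rule sum.inter_filter[symmetric])
  also have "\<dots> = (\<Sum>j<l. P j l * f j)"
    using l by (intro sum.reindex_bij_witness[of _ "\<lambda>j. (j, l)" fst]) (auto simp: T_def)
  finally show ?thesis by (simp add: T_def)
qed

theorem theorem7:
  fixes n d m :: nat
    and F :: "'k::alg_closed_field mpol"
    and X :: "'k mpol fract \<Rightarrow> 'k mpol fract"
  assumes "homogeneous n d F" and "F \<noteq> 0" and "0 < d"
    and "smooth_hypersurface n F"
    and "CHAR('k) = 0 \<or> \<not> CHAR('k) dvd d"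
    and "vector_field n m X"
    and "leaves_invariant n m d F X"
  shows "\<exists>P e. (\<forall>i j. i < j \<and> j \<le> n \<longrightarrow> homogeneous n e (P i j)) \<and>
    induces n m
      (\<lambda>l. \<Sum>(i, j)\<in>{(i, j). i < j \<and> j \<le> n}.
         P i j * (pdiff j F * coord_field i l - pdiff i F * coord_field j l)) X"
proof -
  obtain d' where d': "d = Suc d'" using \<open>0 < d\<close> by (cases d) auto
  \<comment> \<open>The integer \<open>d\<close> vanishes in the field exactly if the characteristic
    divides it. In characteristic 0 this would mean \<open>d = 0\<close>, which positivity of the
    degree excludes.\<close>
  have d: "(of_nat (Suc d') :: 'k) \<noteq> 0"
    using assms(3,5) by (auto simp: of_nat_eq_0_iff_char_dvd d' simp del: of_nat_Suc)
  have F: "homogeneous n (Suc d') F" and inv: "leaves_invariant n m (Suc d') F X"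
    using assms(1,7) by (simp_all add: d')
  obtain G where G: "induces n m G X" "apply_field n G F = 0"
    using invariant_vector_field_lift[OF assms(6) F assms(2) d inv] by blast
  then have hG: "homogeneous n m (G i)" if "i \<le> n" for i using that by (simp add: induces_def)
  obtain P e where P: "\<And>i j. homogeneous n e (P i j)"
    "\<And>l. l \<le> n \<Longrightarrow> G l = (\<Sum>j\<in>{l<..n}. P l j * pdiff j F) - (\<Sum>j<l. P j l * pdiff j F)"
    by (rule partials_syzygy[OF F assms(4) d hG G(2)]) (assumption, rule that)
  have "induces n m G X \<longleftrightarrow> induces n m
      (\<lambda>l. \<Sum>(i, j)\<in>{(i, j). i < j \<and> j \<le> n}.
         P i j * (pdiff j F * coord_field i l - pdiff i F * coord_field j l)) X"
    by (rule induces_cong) (simp only: sum_upper_triangle_coord_field P(2))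
  with G(1) show ?thesis using P(1) by blast
qed

end
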